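(* Consider the real-valued block-sparse setting in the context with Gaussian noise $w\sim N(0,\sigma^2 I_L)$, and assume $x\ne0$. Suppose that for some constant $\alpha\ge 1/(2d\log N)$, $$(1-(d-1)\nu)x_{\min}-(2k-1)d\mu_B x_{\max}\ \ge\ 2\sigma\sqrt{2\alpha d(1+(d-1)\nu)\log N}.$$ Then, with probability exceeding $$1-\frac{0.8\,d\,(2\alpha d\log N)^{d/2-1}}{N^{\alpha d-1}},$$ the BTH algorithm satisfies $S\subseteq\hat S$ (it identifies the correct support of $x$) and $$\|\hat x_{\mathrm{BTH}}-x\|_2^2\le\frac{2\alpha(1+(d-1)\nu)}{(1-(d-1)\nu-(k-1)d\mu_B)^2}\,d\,k\,\sigma^2\log N.$$
   Context: Setting: $N=Md$, $\log$ is the natural logarithm. For $v\in\mathbb{R}^N$, $v[i]=(v_{(i-1)d+1},\dots,v_{id})^T$ is its $i$-th block ($1\le i\le M$); for a matrix $A$ with $N$ columns, $A[i]$ is the submatrix of columns $(i-1)d+1,\dots,id$. The block support is $\mathrm{supp}(v)=\{i:v[i]\ne0\}$; for $I=\{i_1<\dots<i_p\}$, $v_I$ concatenates $v[i_1],\dots,v[i_p]$ and $A_I=[A[i_1],\dots,A[i_p]]$. The unknown deterministic $x\in\mathbb{R}^N$ has at most $k$ nonzero blocks ($k$ known); $S=\mathrm{supp}(x)$, $s=|S|$, $x_{\max}=\max_{i\in S}\|x[i]\|_2$, $x_{\min}=\min_{i\in S}\|x[i]\|_2$. Observations $y=Dx+w$, with $D\in\mathbb{R}^{L\times N}$ known,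 columns $d_1,\dots,d_N$ of unit $\ell_2$ norm, $L<N$, and $D_I$ of full column rank for all $|I|\le k$. Block coherence $\mu_B=\max_{i\ne j}\frac1d\|D[i]^TD[j]\|$ (spectral norm); sub-coherence $\nu=\max_{1\le\ell\le M}\max_{(\ell-1)d+1\le i\ne j\le\ell d}|d_i^Td_j|$. BTH algorithm: compute $\rho_i=\|D[i]^Ty\|_2$, $i=1,\dots,M$; choose a set $\hat S$ of $k$ indices with $\rho_i\ge\rho_j$ for all $i\in\hat S$, $j\notin\hat S$ (ties arbitrary); output $\hat x_{\mathrm{BTH}}$ with $(\hat x_{\mathrm{BTH}})_{\hat S}=D_{\hat S}^\dagger y$ and zero on the other blocks ($^\dagger$ = Moore–Penrose pseudoinverse). *)

theory Defs
  imports "HOL-Probability.Probability"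
begin

text \<open>Conventions: vectors in R^N are functions nat => real, coordinates 0..N-1
 (only these are meaningful).  Block i (0-based, i < M) of a vector consists of
 coordinates i*d ..< (i+1)*d.  The matrix D is a function nat => nat => real,
 D r j = entry in row r < L and column j < N.\<close>

definition blk :: "nat \<Rightarrow> nat \<Rightarrow> nat set" where
  "blk d i = {i*d ..< (i+1)*d}"

definition bnorm :: "nat \<Rightarrow> (nat \<Rightarrow> real) \<Rightarrow> nat \<Rightarrow> real" where
  "bnorm d v i = sqrt (\<Sum>j\<in>blk d i. (v j)^2)"

definition bsupp :: "nat \<Rightarrow> nat \<Rightarrow> (nat \<Rightarrow> real) \<Rightarrow> nat set" where
  "bsupp d M v = {i. i < M \<and> (\<exists>j\<in>blk d i. v j \<noteq> 0)}"

definition col_inner :: "nat \<Rightarrow> (nat \<Rightarrow> nat \<Rightarrow> real) \<Rightarrow> nat \<Rightarrow> nat \<Rightarrow> real" where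
  "col_inner L D a b = (\<Sum>r<L. D r a * D r b)"

definition cross_specnorm :: "nat \<Rightarrow> nat \<Rightarrow> (nat \<Rightarrow> nat \<Rightarrow> real) \<Rightarrow> nat \<Rightarrow> nat \<Rightarrow> real" where
  "cross_specnorm L d D i j =
     Sup {sqrt (\<Sum>a\<in>blk d i. (\<Sum>b\<in>blk d j. col_inner L D a b * u b)^2) | u.
            (\<Sum>b\<in>blk d j. (u b)^2) \<le> 1}"

text \<open>Block coherence mu_B (0 if there are no two distinct blocks).\<close>
definition block_coherence :: "nat \<Rightarrow> nat \<Rightarrow> nat \<Rightarrow> (nat \<Rightarrow> nat \<Rightarrow> real) \<Rightarrow> real" where
  "block_coherence L M d D =
     Max (insert 0 {cross_specnorm L d D i j / real d | i j. i < M \<and> j < M \<and> i \<noteq> j})"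

text \<open>Sub-coherence nu (0 if d = 1).\<close>
definition sub_coherence :: "nat \<Rightarrow> nat \<Rightarrow> nat \<Rightarrow> (nat \<Rightarrow> nat \<Rightarrow> real) \<Rightarrow> real" where
  "sub_coherence L M d D =
     Max (insert 0 {\<bar>col_inner L D a b\<bar> | a b l. l < M \<and> a \<in> blk d l \<and> b \<in> blk d l \<and> a \<noteq> b})"

definition matvec :: "nat \<Rightarrow> (nat \<Rightarrow> nat \<Rightarrow> real) \<Rightarrow> (nat \<Rightarrow> real) \<Rightarrow> nat \<Rightarrow> real" where
  "matvec N D v r = (\<Sum>j<N. D r j * v j)"

definition full_col_rank_on :: "nat \<Rightarrow> nat \<Rightarrow> nat \<Rightarrow> (nat \<Rightarrow> nat \<Rightarrow> real) \<Rightarrow> nat set \<Rightarrow> bool" where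
  "full_col_rank_on L N d D I \<longleftrightarrow>
     (\<forall>v. (\<forall>j<N. (\<exists>i\<in>I. j \<in> blk d i) \<or> v j = 0) \<longrightarrow>
          (\<forall>r<L. matvec N D v r = 0) \<longrightarrow> (\<forall>j<N. v j = 0))"

definition rho :: "nat \<Rightarrow> nat \<Rightarrow> (nat \<Rightarrow> nat \<Rightarrow> real) \<Rightarrow> (nat \<Rightarrow> real) \<Rightarrow> nat \<Rightarrow> real" where
  "rho L d D y i = sqrt (\<Sum>a\<in>blk d i. (\<Sum>r<L. D r a * y r)^2)"

text \<open>Admissible BTH support choice: k indices with the largest rho (ties arbitrary).\<close>
definition bth_select :: "nat \<Rightarrow> nat \<Rightarrow> nat \<Rightarrow> nat \<Rightarrow> (nat \<Rightarrow> nat \<Rightarrow> real) \<Rightarrow> (nat \<Rightarrow> real) \<Rightarrow> nat set \<Rightarrow> bool" where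
  "bth_select L M d k D y Sh \<longleftrightarrow> Sh \<subseteq> {..<M} \<and> card Sh = k \<and>
     (\<forall>i\<in>Sh. \<forall>j\<in>{..<M} - Sh. rho L d D y j \<le> rho L d D y i)"

text \<open>BTH output on Sh: zero outside the blocks of Sh, and on Sh its restriction is
 the least squares solution D_Sh^dagger y, i.e. it solves the normal equations
 D_Sh^T (y - D_Sh z_Sh) = 0 (for full column rank D_Sh this is exactly D_Sh^dagger y).\<close>
definition bth_estimate :: "nat \<Rightarrow> nat \<Rightarrow> nat \<Rightarrow> (nat \<Rightarrow> nat \<Rightarrow> real) \<Rightarrow> (nat \<Rightarrow> real) \<Rightarrow> nat set \<Rightarrow> (nat \<Rightarrow> real) \<Rightarrow> bool" where
  "bth_estimate L N d D y Sh z \<longleftrightarrow>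
     (\<forall>j<N. (\<nexists>i. i \<in> Sh \<and> j \<in> blk d i) \<longrightarrow> z j = 0) \<and>
     (\<forall>a<N. (\<exists>i\<in>Sh. a \<in> blk d i) \<longrightarrow> (\<Sum>r<L. D r a * (y r - matvec N D z r)) = 0)"

definition gauss_noise :: "nat \<Rightarrow> real \<Rightarrow> (nat \<Rightarrow> real) measure" where
  "gauss_noise L \<sigma> = PiM {..<L} (\<lambda>_. density lborel (normal_density 0 \<sigma>))"

end

theory Submission
  imports Defs
begin

text \<open>On the event that every block correlation \<open>D[i]\<^sup>T w\<close> has norm below
  \<open>\<tau> = \<sigma> sqrt (2 \<alpha> d (1 + (d - 1) \<nu>) log N)\<close>, Gershgorin-type bounds on the Gram matrix give both
  conclusions: the hypothesis separates \<open>\<rho>\<^sub>i\<close> on the support from \<open>\<rho>\<^sub>j\<close> off it, and the normal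
  equations bound the error by \<open>sqrt k \<tau> / (1 - (d - 1) \<nu> - (k - 1) d \<mu>\<^sub>B)\<close>.

  For the probability of that event the key fact is that \<open>\<bar>A\<^sup>T w\<bar>\<close> and \<open>\<sigma> \<bar>A g\<bar>\<close> have the same law
  when \<open>w\<close> is \<open>N(0, \<sigma>\<^sup>2 I)\<close> and \<open>g\<close> is standard Gaussian: the Laplace transforms of the squares agree
  by writing \<open>exp (- s \<bar>b\<bar>\<^sup>2)\<close> as a Gaussian characteristic function. With \<open>A = D[i]\<close> this reduces the
  block noise to a chi-square tail with \<open>d\<close> degrees of freedom, with no orthogonalisation, and a
  union bound over the blocks finishes.\<close>

subsection \<open>Gaussian vectors and their quadratic forms\<close>

definition gaussian_vector :: "'i set \<Rightarrow> real \<Rightarrow> ('i \<Rightarrow> real) measure" where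
  "gaussian_vector I \<sigma> = PiM I (\<lambda>_. density lborel (normal_density 0 \<sigma>))"

lemma prob_space_gaussian_vector:
  assumes "\<sigma> > 0"
  shows "prob_space (gaussian_vector I \<sigma>)"
  unfolding gaussian_vector_def using assms by (intro prob_space_PiM prob_space_normal_density)

lemma sets_gaussian_vector [measurable_cong]:
  "sets (gaussian_vector I \<sigma>) = sets (PiM I (\<lambda>_. borel))"
  unfolding gaussian_vector_def by (intro sets_PiM_cong) auto

lemma product_sigma_finite_normal:
  assumes "\<sigma> > 0"
  shows "product_sigma_finite (\<lambda>_::'i. density lborel (normal_density 0 \<sigma>))"
proof -
  interpret prob_space "density lborel (normal_density 0 \<sigma>)"
    using assms by (rule prob_space_normal_density)
  show ?thesis
    by unfold_locales
qed

lemma char_normal: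
  fixes \<sigma> :: real
  assumes "\<sigma> > 0"
  shows "char (density lborel (normal_density 0 \<sigma>)) t = exp (- (\<sigma>\<^sup>2 * t\<^sup>2 / 2))"
proof -
  \<comment> \<open>Rescaling by \<sigma> reduces to the standard normal law, whose characteristic
    function is known.\<close>
  have *: "normal_density 0 \<sigma> (\<sigma> * x) * \<sigma> = std_normal_density x" for x
    using assms by (simp add: normal_density_def power_mult_distrib real_sqrt_mult)
  have "char (density lborel (normal_density 0 \<sigma>)) t
      = (\<integral>x. normal_density 0 \<sigma> x *\<^sub>R iexp (t * x) \<partial>lborel)"
    unfolding char_def by (subst integral_density) auto
  also have "\<dots> = \<sigma> *\<^sub>R (\<integral>x. normal_density 0 \<sigma> (0 + \<sigma> * x) *\<^sub>R iexp (t * (0 + \<sigma> * x)) \<partial>lborel)"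
    using assms by (subst lborel_integral_real_affine[where c = \<sigma> and t = 0]) auto
  also have "\<dots> = (\<integral>x. std_normal_density x *\<^sub>R iexp ((\<sigma> * t) * x) \<partial>lborel)"
    unfolding *[symmetric] by (subst integral_scaleR_right[symmetric]) (simp add: mult_ac)
  also have "\<dots> = char std_normal_distribution (\<sigma> * t)"
    unfolding char_def by (subst integral_density) auto
  finally show ?thesis
    by (simp add: char_std_normal_distribution power_mult_distrib)
qed

lemma char_gaussian_vector:
  fixes \<sigma> :: real
  assumes "finite I" "\<sigma> > 0"
  shows "(\<integral>w. iexp (\<Sum>i\<in>I. a i * w i) \<partial>gaussian_vector I \<sigma>)
    = exp (- (\<sigma>\<^sup>2 * (\<Sum>i\<in>I. (a i)\<^sup>2) / 2))"
proof -
  interpret product_sigma_finite "\<lambda>_::'a. density lborel (normal_density 0 \<sigma>)"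
    using assms(2) by (rule product_sigma_finite_normal)
  interpret N: prob_space "density lborel (normal_density 0 \<sigma>)"
    using assms by (intro prob_space_normal_density)
  have "(\<integral>w. iexp (\<Sum>i\<in>I. a i * w i) \<partial>gaussian_vector I \<sigma>)
      = (\<integral>w. (\<Prod>i\<in>I. iexp (a i * w i)) \<partial>gaussian_vector I \<sigma>)"
    using assms(1) by (simp add: exp_sum sum_distrib_left)
  also have "\<dots> = (\<Prod>i\<in>I. char (density lborel (normal_density 0 \<sigma>)) (a i))"
    unfolding gaussian_vector_def char_def using assms(1)
    by (intro product_integral_prod N.integrable_const_bound[where B = 1]) auto
  also have "\<dots> = exp (- (\<sigma>\<^sup>2 * (\<Sum>i\<in>I. (a i)\<^sup>2) / 2))"
    using assms by (simp add: char_normal exp_sum[symmetric] sum_negf sum_divide_distrib sum_distrib_left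
        flip: of_real_prod)
  finally show ?thesis .
qed

text \<open>Both sides equal the integral of \<open>exp (\<i> c \<langle>A\<^sup>T w, g\<rangle>)\<close> over the product space, because
  \<open>exp (- s \<bar>b\<bar>\<^sup>2)\<close> is itself a Gaussian characteristic function in \<open>b\<close>.\<close>
lemma gaussian_laplace_duality:
  fixes \<sigma> s :: real and A :: "'i \<Rightarrow> 'j \<Rightarrow> real"
  assumes [simp]: "finite I" "finite J" and "\<sigma> > 0" "s \<ge> 0"
  shows "(\<integral>w. exp (- (s * (\<Sum>j\<in>J. (\<Sum>i\<in>I. A i j * w i)\<^sup>2))) \<partial>gaussian_vector I \<sigma>)
    = (\<integral>g. exp (- (s * (\<sigma>\<^sup>2 * (\<Sum>i\<in>I. (\<Sum>j\<in>J. A i j * g j)\<^sup>2)))) \<partial>gaussian_vector J 1)"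
    (is "?L = ?R")
proof -
  \<comment> \<open>Chosen so that the characteristic function of a standard Gaussian at
    \<open>c * b\<close> is \<open>exp (- (s * b\<^sup>2))\<close>.\<close>
  define c where "c = sqrt (2 * s)"
  have c2: "c\<^sup>2 = 2 * s" using assms by (simp add: c_def)
  interpret W: prob_space "gaussian_vector I \<sigma>"
    using assms by (intro prob_space_gaussian_vector)
  interpret G: prob_space "gaussian_vector J 1"
    by (intro prob_space_gaussian_vector) simp
  interpret WG: pair_prob_space "gaussian_vector I \<sigma>" "gaussian_vector J 1" ..
  have "complex_of_real ?L = (\<integral>w. (\<integral>g. iexp (\<Sum>j\<in>J. (c * (\<Sum>i\<in>I. A i j * w i)) * g j)
      \<partial>gaussian_vector J 1) \<partial>gaussian_vector I \<sigma>)"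
    by (subst char_gaussian_vector)
      (simp_all add: power_mult_distrib c2 sum_distrib_left[symmetric] flip: integral_complex_of_real)
  \<comment> \<open>The integrand has modulus 1 on a product of probability spaces, so Fubini
    applies.\<close>
  also have "\<dots> = (\<integral>g. (\<integral>w. iexp (\<Sum>j\<in>J. (c * (\<Sum>i\<in>I. A i j * w i)) * g j)
      \<partial>gaussian_vector I \<sigma>) \<partial>gaussian_vector J 1)"
    by (intro WG.Fubini_integral[symmetric] WG.P.integrable_const_bound[where B = 1])
      (auto simp: split_beta')
  also have "\<dots> = (\<integral>g. (\<integral>w. iexp (\<Sum>i\<in>I. (c * (\<Sum>j\<in>J. A i j * g j)) * w i)
      \<partial>gaussian_vector I \<sigma>) \<partial>gaussian_vector J 1)"
  proof -
    have "(\<Sum>j\<in>J. (c * (\<Sum>i\<in>I. A i j * w i)) * g j) = (\<Sum>i\<in>I. (c * (\<Sum>j\<in>J. A i j * g j)) * w i)"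
      for w g
      by (simp add: sum_distrib_left sum_distrib_right mult_ac, subst sum.swap, rule refl)
    then show ?thesis by simp
  qed
  also have "\<dots> = complex_of_real ?R"
    using assms by (subst char_gaussian_vector)
      (simp_all add: power_mult_distrib c2 sum_distrib_left[symmetric] mult_ac flip: integral_complex_of_real)
  finally show ?thesis by (simp only: of_real_eq_iff)
qed

section \<open>Laws determined by moments and by Laplace transforms\<close>

text \<open>On \<open>[-1, 1]\<close> all absolute moments are at most 1, so the Taylor expansion of
  the characteristic function converges to it at every \<open>t\<close>. The moments thus fix the
  characteristic function, and Levy uniqueness fixes the measure.\<close>

lemma bounded_moments_unique:
  fixes \<mu> \<nu> :: "real measure"
  assumes "real_distribution \<mu>" "real_distribution \<nu>"
    and "AE x in \<mu>. \<bar>x\<bar> \<le> 1" "AE x in \<nu>. \<bar>x\<bar> \<le> 1"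
    and mom: "\<And>k::nat. (\<integral>x. x ^ k \<partial>\<mu>) = (\<integral>x. x ^ k \<partial>\<nu>)"
  shows "\<mu> = \<nu>"
proof (rule Levy_uniqueness[OF assms(1,2)], rule ext)
  fix t :: real
  let ?p = "\<lambda>\<mu> n. \<Sum>k\<le>n. ((\<i> * t)^k / fact k) * complex_of_real (\<integral>x. x ^ k \<partial>\<mu>)"
  have lim: "?p \<mu> \<longlonglongrightarrow> char \<mu> t"
    if "real_distribution \<mu>" and bd: "AE x in \<mu>. \<bar>x\<bar> \<le> 1" for \<mu> :: "real measure"
  proof -
    interpret real_distribution \<mu> by fact
    have int: "integrable \<mu> (\<lambda>x. x ^ k)" for k
    proof (rule integrable_const_bound[where B = 1])
      show "AE x in \<mu>. norm (x ^ k) \<le> 1"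
        using bd by eventually_elim (simp add: power_abs power_le_one)
    qed simp
    have le1: "expectation (\<lambda>x. \<bar>x\<bar> ^ k) \<le> 1" for k
    proof -
      have "expectation (\<lambda>x. \<bar>x\<bar> ^ k) \<le> expectation (\<lambda>x. 1)"
        using integrable_abs[OF int[of k]] bd
        by (intro integral_mono_AE) (auto simp: power_abs elim!: eventually_mono intro: power_le_one)
      with prob_space show ?thesis by simp
    qed
    have "cmod (?p \<mu> n - char \<mu> t) \<le> 2 * (\<bar>t\<bar> ^ n / fact n)" for n
    proof -
      have "cmod (?p \<mu> n - char \<mu> t) \<le> (2 * \<bar>t\<bar> ^ n / fact n) * expectation (\<lambda>x. \<bar>x\<bar> ^ n)"
        using char_approx1[of n t, OF int] by (simp add: norm_minus_commute)
      also have "\<dots> \<le> (2 * \<bar>t\<bar> ^ n / fact n) * 1"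
        by (intro mult_left_mono le1) auto
      finally show ?thesis by simp
    qed
    moreover have "(\<lambda>n. 2 * (\<bar>t\<bar> ^ n / fact n)) \<longlonglongrightarrow> 0"
      using tendsto_mult[OF tendsto_const summable_LIMSEQ_zero[OF summable_exp[of "\<bar>t\<bar>"]], of 2]
      by (simp add: divide_inverse mult_ac)
    ultimately have "(\<lambda>n. ?p \<mu> n - char \<mu> t) \<longlonglongrightarrow> 0"
      by (intro Lim_null_comparison[of "\<lambda>n. ?p \<mu> n - char \<mu> t"]) (auto intro: always_eventually)
    then show ?thesis by (rule LIM_zero_cancel)
  qed
  have "?p \<mu> = ?p \<nu>" by (simp add: mom)
  with lim[OF assms(1,3)] lim[OF assms(2,4)] show "char \<mu> t = char \<nu> t"
    using LIMSEQ_unique by metis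
qed

text \<open>Integer arguments suffice: the values there are the moments of \<open>exp (- Y)\<close>,
  which lies in \<open>(0, 1]\<close>, so \<open>bounded_moments_unique\<close> applies, and
  \<open>- ln\<close> carries the law back to \<open>Y\<close>.\<close>

lemma laplace_transform_unique:
  fixes Y :: "'a \<Rightarrow> real" and Z :: "'b \<Rightarrow> real"
  assumes "prob_space P" "prob_space Q"
    and [measurable]: "Y \<in> borel_measurable P" "Z \<in> borel_measurable Q"
    and nonneg: "\<And>x. Y x \<ge> 0" "\<And>x. Z x \<ge> 0"
    and eq: "\<And>n::nat. (\<integral>x. exp (- (real n * Y x)) \<partial>P) = (\<integral>x. exp (- (real n * Z x)) \<partial>Q)"
  shows "distr P borel Y = distr Q borel Z"
proof -
  interpret P: prob_space P by fact
  interpret Q: prob_space Q by fact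
  have "distr P borel (\<lambda>x. exp (- Y x)) = distr Q borel (\<lambda>x. exp (- Z x))"
    using nonneg eq
    by (intro bounded_moments_unique P.real_distribution_distr Q.real_distribution_distr)
      (auto simp: AE_distr_iff integral_distr simp flip: exp_of_nat_mult)
  then have "distr (distr P borel (\<lambda>x. exp (- Y x))) borel (\<lambda>u. - ln u)
      = distr (distr Q borel (\<lambda>x. exp (- Z x))) borel (\<lambda>u. - ln u)"
    by simp
  then show ?thesis
    by (simp add: distr_distr comp_def)
qed

text \<open>Squared norms are nonnegative, so equal Laplace transforms give equal laws. The gain is
  that the Gaussian vector on the right has only \<open>card J\<close> coordinates.\<close>

lemma law_norm_transpose:
  fixes \<sigma> :: real and A :: "'i \<Rightarrow> 'j \<Rightarrow> real"
  assumes "finite I" "finite J" and "\<sigma> > 0"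
  shows "distr (gaussian_vector I \<sigma>) borel (\<lambda>w. \<Sum>j\<in>J. (\<Sum>i\<in>I. A i j * w i)\<^sup>2)
    = distr (gaussian_vector J 1) borel (\<lambda>g. \<sigma>\<^sup>2 * (\<Sum>i\<in>I. (\<Sum>j\<in>J. A i j * g j)\<^sup>2))"
  using assms
  by (intro laplace_transform_unique prob_space_gaussian_vector gaussian_laplace_duality)
    (auto intro!: sum_nonneg mult_nonneg_nonneg)

lemma tail_eq_of_distr_eq:
  fixes Y :: "'a \<Rightarrow> real" and Z :: "'b \<Rightarrow> real"
  assumes "distr P borel Y = distr Q borel Z"
    and [measurable]: "Y \<in> borel_measurable P" "Z \<in> borel_measurable Q"
  shows "measure P {x \<in> space P. t \<le> Y x} = measure Q {x \<in> space Q. t \<le> Z x}"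
proof -
  have "measure (distr P borel Y) {t..} = measure (distr Q borel Z) {t..}"
    by (simp add: assms(1))
  then show ?thesis
    by (simp add: measure_distr vimage_def Int_def conj_commute)
qed

text \<open>The operator bound is applied pointwise after the transposition. Applied directly to
  \<open>w\<close> it would leave \<open>card I\<close> degrees of freedom; after the exchange only
  \<open>card J\<close> remain.\<close>

lemma gaussian_tail_le_chi_square:
  fixes \<sigma> c :: real and A :: "'i \<Rightarrow> 'j \<Rightarrow> real"
  assumes [simp]: "finite I" "finite J" and pos: "\<sigma> > 0" "c > 0"
    and op: "\<And>g. (\<Sum>i\<in>I. (\<Sum>j\<in>J. A i j * g j)\<^sup>2) \<le> c * (\<Sum>j\<in>J. (g j)\<^sup>2)"
  shows "measure (gaussian_vector I \<sigma>)
        {w \<in> space (gaussian_vector I \<sigma>). \<sigma>\<^sup>2 * c * t \<le> (\<Sum>j\<in>J. (\<Sum>i\<in>I. A i j * w i)\<^sup>2)}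
    \<le> measure (gaussian_vector J 1) {g \<in> space (gaussian_vector J 1). t \<le> (\<Sum>j\<in>J. (g j)\<^sup>2)}"
proof -
  interpret G: prob_space "gaussian_vector J 1"
    by (intro prob_space_gaussian_vector) simp
  have "measure (gaussian_vector I \<sigma>)
        {w \<in> space (gaussian_vector I \<sigma>). \<sigma>\<^sup>2 * c * t \<le> (\<Sum>j\<in>J. (\<Sum>i\<in>I. A i j * w i)\<^sup>2)}
      = measure (gaussian_vector J 1) {g \<in> space (gaussian_vector J 1).
          \<sigma>\<^sup>2 * c * t \<le> \<sigma>\<^sup>2 * (\<Sum>i\<in>I. (\<Sum>j\<in>J. A i j * g j)\<^sup>2)}"
    using pos by (intro tail_eq_of_distr_eq law_norm_transpose) auto
  also have "\<dots> \<le> measure (gaussian_vector J 1) {g \<in> space (gaussian_vector J 1). t \<le> (\<Sum>j\<in>J. (g j)\<^sup>2)}"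
  proof (intro G.finite_measure_mono, safe)
    fix g
    assume "\<sigma>\<^sup>2 * c * t \<le> \<sigma>\<^sup>2 * (\<Sum>i\<in>I. (\<Sum>j\<in>J. A i j * g j)\<^sup>2)"
    then have "c * t \<le> (\<Sum>i\<in>I. (\<Sum>j\<in>J. A i j * g j)\<^sup>2)"
      using pos by (simp add: mult.assoc)
    with op[of g] have "c * t \<le> c * (\<Sum>j\<in>J. (g j)\<^sup>2)" by simp
    then show "t \<le> (\<Sum>j\<in>J. (g j)\<^sup>2)" using pos by simp
  qed simp
  finally show ?thesis .
qed

subsection \<open>The chi-square tail\<close>

text \<open>Mills ratio bound: for \<open>y \<ge> a = sqrt t\<close> the density is at most
  \<open>y / a\<close> times itself, and that product has the antiderivative
  \<open>- std_normal_density y / a\<close>.\<close>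

lemma nn_integral_std_normal_tail_le:
  fixes t :: real
  assumes "t > 0"
  shows "(\<integral>\<^sup>+y. ennreal (std_normal_density y) * indicator {y. t \<le> y\<^sup>2} y \<partial>lborel)
    \<le> ennreal (sqrt (2 / pi) * t powr (-1/2) * exp (- t / 2))"
proof -
  define a where "a = sqrt t"
  have a: "a > 0" "a\<^sup>2 = t" using assms by (auto simp: a_def)
  let ?f = "\<lambda>y. y / a * std_normal_density y"
  have half: "(\<integral>\<^sup>+y. ennreal (?f y) * indicator {a..} y \<partial>lborel) = ennreal (std_normal_density a / a)"
  proof -
    have "(\<integral>\<^sup>+y. ennreal (?f y) * indicator {a..} y \<partial>lborel)
        = ennreal (0 - (- std_normal_density a / a))"
    proof (rule nn_integral_FTC_atLeast[where F = "\<lambda>y. - std_normal_density y / a"])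
      show "((\<lambda>y. - std_normal_density y / a) has_real_derivative ?f y) (at y)" for y
        unfolding std_normal_density_def using a by (auto intro!: derivative_eq_intros simp: field_simps)
      show "((\<lambda>y. - std_normal_density y / a) \<longlongrightarrow> 0) at_top"
        unfolding std_normal_density_def using a by real_asymp
    qed (use a in auto)
    then show ?thesis by simp
  qed
  \<comment> \<open>The left tail is the mirror image of the right one.\<close>
  have half': "(\<integral>\<^sup>+y. ennreal (?f (- y)) * indicator {a..} (- y) \<partial>lborel) = ennreal (std_normal_density a / a)"
    by (subst half[symmetric], subst (2) nn_integral_real_affine[where c = "-1" and t = 0]) auto
  have "(\<integral>\<^sup>+y. ennreal (std_normal_density y) * indicator {y. t \<le> y\<^sup>2} y \<partial>lborel)
      \<le> (\<integral>\<^sup>+y. ennreal (?f y) * indicator {a..} y + ennreal (?f (- y)) * indicator {a..} (- y) \<partial>lborel)"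
  proof (intro nn_integral_mono)
    fix y :: real
    show "ennreal (std_normal_density y) * indicator {y. t \<le> y\<^sup>2} y
      \<le> ennreal (?f y) * indicator {a..} y + ennreal (?f (- y)) * indicator {a..} (- y)"
    proof (cases "t \<le> y\<^sup>2")
      case True
      then have "a \<le> \<bar>y\<bar>" using real_sqrt_le_mono[OF True] by (simp add: a_def)
      then consider "a \<le> y" | "a \<le> - y" by linarith
      then show ?thesis
      proof cases
        case 1
        have "std_normal_density y * 1 \<le> std_normal_density y * (y / a)"
          using 1 a by (intro mult_left_mono) auto
        then show ?thesis using 1 a by (auto simp: mult_ac intro!: ennreal_leI)
      next
        case 2
        have "std_normal_density y * 1 \<le> std_normal_density y * (- y / a)"
          using 2 a by (intro mult_left_mono) (auto simp: field_simps)
        then have "ennreal (std_normal_density y) \<le> ennreal (?f (- y))"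
          by (intro ennreal_leI) (simp add: std_normal_density_def mult_ac)
        then show ?thesis using 2 True by (simp add: add_increasing)
      qed
    qed simp
  qed
  also have "\<dots> = ennreal (std_normal_density a / a) + ennreal (std_normal_density a / a)"
    by (subst nn_integral_add) (simp_all only: half half', simp_all)
  also have "\<dots> = ennreal (2 * std_normal_density a / a)"
    using a by (simp flip: ennreal_plus)
  also have "2 * std_normal_density a / a = sqrt (2 / pi) * t powr (-1/2) * exp (- t / 2)"
  proof -
    have "t powr (-1/2) = 1 / a"
      using assms by (simp add: a_def powr_minus_divide powr_half_sqrt)
    moreover have "2 / sqrt (2 * pi) = sqrt (2 / pi)"
      by (simp add: real_sqrt_mult real_sqrt_divide real_div_sqrt field_simps)
    moreover have "2 * std_normal_density a / a = 2 / sqrt (2 * pi) * (1 / a) * exp (- t / 2)"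
      by (simp add: std_normal_density_def a(2))
    ultimately show ?thesis by simp
  qed
  finally show ?thesis .
qed

text \<open>Source of the constant 0.8. The claim amounts to \<open>pi > 3.125\<close>; otherwise
  \<open>pi / 6 < 0.521\<close>, and monotonicity of the sine contradicts
  \<open>sin (pi / 6) = 1 / 2\<close>, since a Taylor bound gives
  \<open>sin 0.521 < 1 / 2\<close>.\<close>

lemma sqrt_two_over_pi_less: "sqrt (2 / pi) < 0.8"
proof -
  have "pi > 3.125"
  proof (rule ccontr)
    assume "\<not> pi > 3.125"
    then have "sin (pi / 6) \<le> sin (0.521 :: real)"
      by (intro sin_monotone_2pi_le) (use pi_gt3 in auto)
    moreover have "sin (0.521 :: real) < 1 / 2"
    proof -
      have "sin (0.521 :: real) \<le> (\<Sum>i<5. sin_coeff i * 0.521 ^ i) + inverse (fact 5) * \<bar>0.521\<bar> ^ 5"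
        using Maclaurin_sin_bound[of "0.521" 5] by (simp add: abs_le_iff)
      also have "\<dots> < 1 / 2"
        by (simp add: sin_coeff_def lessThan_nat_numeral fact_numeral field_simps)
      finally show ?thesis .
    qed
    ultimately show False by (simp add: sin_30)
  qed
  then have "2 / pi < 0.8\<^sup>2" by (simp add: field_simps power2_eq_square)
  then have "sqrt (2 / pi) < sqrt (0.8\<^sup>2)" by (rule real_sqrt_less_mono)
  then show ?thesis by simp
qed

text \<open>The number of degrees of freedom is \<open>card I\<close>. An arbitrary index set lets
  \<open>I\<close> be a block of columns and lets a single coordinate be split off.\<close>

abbreviation chi_square_tail :: "'i set \<Rightarrow> real \<Rightarrow> real" where
  "chi_square_tail I t \<equiv>
    measure (gaussian_vector I 1) {g \<in> space (gaussian_vector I 1). t \<le> (\<Sum>i\<in>I. (g i)\<^sup>2)}"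

lemma emeasure_Collect_nn_integral:
  assumes "{x \<in> space M. P x} \<in> sets M"
  shows "emeasure M {x \<in> space M. P x} = (\<integral>\<^sup>+x. indicator {x. P x} x \<partial>M)"
  unfolding nn_integral_indicator[OF assms, symmetric]
  by (intro nn_integral_cong) (simp split: split_indicator)

text \<open>One degree of freedom is kept apart: the power of \<open>t\<close> is negative here,
  while the induction for higher dimensions starts at two with exponent 0.\<close>

lemma chi_square_tail_1:
  assumes "card I = 1" "t > 0"
  shows "chi_square_tail I t \<le> sqrt (2 / pi) * t powr (-1/2) * exp (- t / 2)"
proof -
  obtain i where I: "I = {i}" using assms(1) by (auto simp: card_1_singleton_iff)
  interpret product_sigma_finite "\<lambda>_::'a. density lborel (normal_density 0 1)"
    by (rule product_sigma_finite_normal) simp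
  interpret G: prob_space "gaussian_vector I 1"
    by (intro prob_space_gaussian_vector) simp
  have "ennreal (chi_square_tail I t)
      = (\<integral>\<^sup>+g. indicator {y. t \<le> y\<^sup>2} (g i) \<partial>gaussian_vector I 1)"
    unfolding G.emeasure_eq_measure[symmetric]
    by (subst emeasure_Collect_nn_integral)
      (auto simp: I intro!: nn_integral_cong split: split_indicator)
  also have "\<dots> = (\<integral>\<^sup>+y. indicator {y. t \<le> y\<^sup>2} y \<partial>density lborel (normal_density 0 1))"
    unfolding gaussian_vector_def I by (intro product_nn_integral_singleton) simp
  also have "\<dots> \<le> ennreal (sqrt (2 / pi) * t powr (-1/2) * exp (- t / 2))"
    using nn_integral_std_normal_tail_le[OF assms(2)] by (subst nn_integral_density) auto
  finally show ?thesis by simp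
qed

section \<open>Chi-square tails from two degrees of freedom upwards\<close>

text \<open>Multiplying the standard density by \<open>exp (- (s * x\<^sup>2))\<close> gives
  \<open>r\<close> times the normal density of standard deviation
  \<open>r = 1 / sqrt (1 + 2 * s)\<close>, which integrates to 1.\<close>

lemma laplace_normal_square:
  fixes s :: real
  assumes "s \<ge> 0"
  shows "(\<integral>x. exp (- (s * x\<^sup>2)) \<partial>density lborel (normal_density 0 1)) = 1 / sqrt (1 + 2 * s)"
proof -
  define r where "r = 1 / sqrt (1 + 2 * s)"
  have r: "r > 0" "r\<^sup>2 = 1 / (1 + 2 * s)"
    using assms by (auto simp: r_def power_divide)
  have "normal_density 0 1 x * exp (- (s * x\<^sup>2)) = r * normal_density 0 r x" for x
  proof -
    have "sqrt (2 * pi * r\<^sup>2) = sqrt (2 * pi) * r"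
      using r(1) by (simp add: real_sqrt_mult)
    then have "r * normal_density 0 r x = 1 / sqrt (2 * pi) * exp (- x\<^sup>2 / (2 * r\<^sup>2))"
      using r(1) by (simp add: normal_density_def)
    also have "- x\<^sup>2 / (2 * r\<^sup>2) = - x\<^sup>2 / 2 + - (s * x\<^sup>2)"
      using assms by (simp add: r field_simps)
    finally have "r * normal_density 0 r x = 1 / sqrt (2 * pi) * (exp (- x\<^sup>2 / 2) * exp (- (s * x\<^sup>2)))"
      by (simp only: exp_add)
    then show ?thesis
      by (simp add: normal_density_def)
  qed
  then have "(\<integral>x. exp (- (s * x\<^sup>2)) \<partial>density lborel (normal_density 0 1))
      = (\<integral>x. r * normal_density 0 r x \<partial>lborel)"
    by (subst integral_density) auto
  also have "\<dots> = r" using r by simp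
  finally show ?thesis by (simp add: r_def)
qed

text \<open>Tilting changes the rate from \<open>l\<close> to \<open>l + s\<close>. The density
  vanishes on the negative half-line, so the absolute value does not alter the integral; it makes
  the variable nonnegative at every point, as \<open>laplace_transform_unique\<close>
  requires.\<close>

lemma laplace_exponential:
  fixes l s :: real
  assumes "l > 0" "s \<ge> 0"
  shows "(\<integral>x. exp (- (s * \<bar>x\<bar>)) \<partial>density lborel (exponential_density l)) = l / (l + s)"
proof -
  interpret E: prob_space "density lborel (exponential_density (l + s))"
    using assms by (intro prob_space_exponential_density) simp
  have "exponential_density l x * exp (- (s * \<bar>x\<bar>)) = l / (l + s) * exponential_density (l + s) x" for x
    using assms by (auto simp: exponential_density_def field_simps simp flip: exp_add)
  then have "(\<integral>x. exp (- (s * \<bar>x\<bar>)) \<partial>density lborel (exponential_density l))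
      = (\<integral>x. l / (l + s) * exponential_density (l + s) x \<partial>lborel)"
    using assms by (subst integral_density) auto
  also have "\<dots> = l / (l + s) * (\<integral>x. exponential_density (l + s) x \<partial>lborel)"
    by simp
  also have "(\<integral>x. exponential_density (l + s) x \<partial>lborel) = 1"
    using integral_density[of "\<lambda>_. 1 :: real" lborel "exponential_density (l + s)"] E.prob_space assms
    by (simp add: exponential_density_nonneg cong: AE_cong)
  finally show ?thesis by simp
qed

text \<open>A sum of two squares is exponential with rate 1/2: the product of two factors
  \<open>1 / sqrt (1 + 2 * n)\<close> is the Laplace transform \<open>(1/2) / (1/2 + n)\<close>.
  This exact tail is the base of the induction on the dimension.\<close>

lemma chi_square_tail_2:
  assumes "card I = 2" "t \<ge> 0"
  shows "chi_square_tail I t = exp (- t / 2)"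
proof -
  have fin [simp]: "finite I" using assms(1) by (simp add: card_ge_0_finite)
  let ?E = "density lborel (exponential_density (1/2))"
  interpret product_sigma_finite "\<lambda>_::'a. density lborel (normal_density 0 1)"
    by (rule product_sigma_finite_normal) simp
  interpret N: prob_space "density lborel (normal_density 0 1)"
    by (rule prob_space_normal_density) simp
  interpret E: prob_space ?E
    by (intro prob_space_exponential_density) simp
  have "distr (gaussian_vector I 1) borel (\<lambda>g. \<Sum>i\<in>I. (g i)\<^sup>2) = distr ?E borel abs"
  proof (intro laplace_transform_unique prob_space_gaussian_vector E.prob_space_axioms)
    fix n :: nat
    have "(\<integral>g. exp (- (real n * (\<Sum>i\<in>I. (g i)\<^sup>2))) \<partial>gaussian_vector I 1)
        = (\<integral>g. (\<Prod>i\<in>I. exp (- (real n * (g i)\<^sup>2))) \<partial>gaussian_vector I 1)"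
      by (simp add: exp_sum sum_distrib_left sum_negf[symmetric])
    also have "\<dots> = (\<Prod>i\<in>I. \<integral>x. exp (- (real n * x\<^sup>2)) \<partial>density lborel (normal_density 0 1))"
      unfolding gaussian_vector_def
      by (intro product_integral_prod N.integrable_const_bound[where B = 1]) auto
    also have "\<dots> = (1 / sqrt (1 + 2 * real n))\<^sup>2"
      by (simp only: laplace_normal_square[OF of_nat_0_le_iff] prod_constant assms(1))
    also have "\<dots> = (1/2) / (1/2 + real n)"
      by (simp add: power_divide divide_simps)
    also have "\<dots> = (\<integral>x. exp (- (real n * \<bar>x\<bar>)) \<partial>?E)"
      by (rule laplace_exponential[symmetric]) auto
    finally show "(\<integral>g. exp (- (real n * (\<Sum>i\<in>I. (g i)\<^sup>2))) \<partial>gaussian_vector I 1)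
      = (\<integral>x. exp (- (real n * \<bar>x\<bar>)) \<partial>?E)" .
  qed (auto intro: sum_nonneg)
  then have "chi_square_tail I t = measure ?E {x \<in> space ?E. t \<le> \<bar>x\<bar>}"
    by (rule tail_eq_of_distr_eq) auto
  also have "\<dots> = exp (- t / 2)"
  proof -
    have "emeasure ?E {x \<in> space ?E. t \<le> \<bar>x\<bar>}
        = (\<integral>\<^sup>+x. ennreal (exponential_density (1/2) x) * indicator {x. t \<le> \<bar>x\<bar>} x \<partial>lborel)"
      by (subst emeasure_density) auto
    also have "\<dots> = (\<integral>\<^sup>+x. ennreal (1/2 * exp (- x / 2)) * indicator {t..} x \<partial>lborel)"
    proof (intro nn_integral_cong)
      fix x :: real
      show "ennreal (exponential_density (1/2) x) * indicator {x. t \<le> \<bar>x\<bar>} x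
          = ennreal (1/2 * exp (- x / 2)) * indicator {t..} x"
        using assms(2) by (cases "x < 0") (auto simp: exponential_density_def indicator_def)
    qed
    also have "\<dots> = ennreal (0 - (- exp (- t / 2)))"
    proof (rule nn_integral_FTC_atLeast[where F = "\<lambda>x. - exp (- x / 2)"])
      show "((\<lambda>x. - exp (- x / 2)) has_real_derivative 1/2 * exp (- x / 2)) (at x)" for x :: real
        by (auto intro!: derivative_eq_intros)
      show "((\<lambda>x. - exp (- x / 2) :: real) \<longlongrightarrow> 0) at_top"
        by real_asymp
    qed auto
    finally show ?thesis by (simp add: E.emeasure_eq_measure)
  qed
  finally show ?thesis .
qed

text \<open>Conditioning on one coordinate \<open>y\<close>, the factor \<open>exp (y\<^sup>2 / 2)\<close> from the inductive bound
  cancels the Gaussian density of \<open>y\<close>.\<close>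
lemma chi_square_tail_insert:
  assumes "finite I" "i \<notin> I" and "t > 0" "K \<ge> 0"
    and IH: "\<And>u. 0 \<le> u \<Longrightarrow> u \<le> t \<Longrightarrow> chi_square_tail I u \<le> K * exp (- u / 2)"
  shows "chi_square_tail (insert i I) t
    \<le> sqrt (2 / pi) * (t powr (-1/2) + K * sqrt t) * exp (- t / 2)"
proof -
  interpret product_sigma_finite "\<lambda>_::'a. density lborel (normal_density 0 1)"
    by (rule product_sigma_finite_normal) simp
  interpret G: prob_space "gaussian_vector I 1"
    by (intro prob_space_gaussian_vector) simp
  interpret G': prob_space "gaussian_vector (insert i I) 1"
    by (intro prob_space_gaussian_vector) simp
  \<comment> \<open>The density at \<open>y\<close> times
    \<open>K * exp (- (t - y\<^sup>2) / 2)\<close>; it does not depend on \<open>y\<close>.\<close>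
  let ?c = "K * exp (- t / 2) / sqrt (2 * pi)"
  have "ennreal (chi_square_tail (insert i I) t)
      = (\<integral>\<^sup>+g. indicator {g. t \<le> (\<Sum>j\<in>insert i I. (g j)\<^sup>2)} g \<partial>gaussian_vector (insert i I) 1)"
    unfolding G'.emeasure_eq_measure[symmetric] using assms(1)
    by (subst emeasure_Collect_nn_integral) measurable
  also have "\<dots> = (\<integral>\<^sup>+y. (\<integral>\<^sup>+g. indicator {g. t \<le> (\<Sum>j\<in>insert i I. (g j)\<^sup>2)} (g(i := y))
      \<partial>gaussian_vector I 1) \<partial>density lborel (normal_density 0 1))"
    unfolding gaussian_vector_def using assms(1,2)
    by (intro product_nn_integral_insert_rev) auto
  also have "\<dots> = (\<integral>\<^sup>+y. ennreal (chi_square_tail I (t - y\<^sup>2)) \<partial>density lborel (normal_density 0 1))"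
  proof (intro nn_integral_cong)
    fix y :: real
    have *: "(\<Sum>j\<in>I. ((g(i := y)) j)\<^sup>2) = (\<Sum>j\<in>I. (g j)\<^sup>2)" for g
      using assms(2) by (intro sum.cong) auto
    show "(\<integral>\<^sup>+g. indicator {g. t \<le> (\<Sum>j\<in>insert i I. (g j)\<^sup>2)} (g(i := y)) \<partial>gaussian_vector I 1)
      = ennreal (chi_square_tail I (t - y\<^sup>2))"
      unfolding G.emeasure_eq_measure[symmetric] using assms(1,2)
      by (subst emeasure_Collect_nn_integral)
        (auto intro!: nn_integral_cong simp: * fun_upd_same algebra_simps split: split_indicator simp del: fun_upd_apply)
  qed
  also have "\<dots> = (\<integral>\<^sup>+y. ennreal (std_normal_density y) * ennreal (chi_square_tail I (t - y\<^sup>2)) \<partial>lborel)"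
  proof (intro nn_integral_density)
    \<comment> \<open>A tail probability decreases in its threshold, so its negative is monotone and
      hence Borel measurable.\<close>
    have "(\<lambda>u. - chi_square_tail I u) \<in> borel_measurable borel"
      using assms(1) by (intro borel_measurable_mono monoI) (auto intro!: G.finite_measure_mono)
    then have "(\<lambda>u. - (- chi_square_tail I u)) \<in> borel_measurable borel"
      by (rule borel_measurable_uminus)
    then have [measurable]: "chi_square_tail I \<in> borel_measurable borel"
      by (simp only: minus_minus)
    show "(\<lambda>y. ennreal (chi_square_tail I (t - y\<^sup>2))) \<in> borel_measurable lborel"
      by measurable
  qed simp
  \<comment> \<open>Where \<open>t \<le> y\<^sup>2\<close> the conditional probability is bounded by
    1; elsewhere \<open>IH\<close> yields the constant \<open>?c\<close> on an interval of length
    \<open>2 * sqrt t\<close>.\<close>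
  also have "\<dots> \<le> (\<integral>\<^sup>+y. ennreal (std_normal_density y) * indicator {y. t \<le> y\<^sup>2} y
      + ennreal ?c * indicator {- sqrt t..sqrt t} y \<partial>lborel)"
  proof (intro nn_integral_mono)
    fix y :: real
    show "ennreal (std_normal_density y) * ennreal (chi_square_tail I (t - y\<^sup>2))
      \<le> ennreal (std_normal_density y) * indicator {y. t \<le> y\<^sup>2} y
        + ennreal ?c * indicator {- sqrt t..sqrt t} y"
    proof (cases "t \<le> y\<^sup>2")
      case True
      have "ennreal (std_normal_density y) * ennreal (chi_square_tail I (t - y\<^sup>2))
          \<le> ennreal (std_normal_density y) * 1"
        by (intro mult_left_mono) (auto simp: G.prob_le_1)
      then show ?thesis using True by (simp add: add_increasing2)
    next
      case False
      then have "\<bar>y\<bar> \<le> sqrt t" by (intro real_le_rsqrt) simp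
      have "std_normal_density y * chi_square_tail I (t - y\<^sup>2)
          \<le> std_normal_density y * (K * exp (- (t - y\<^sup>2) / 2))"
        using False by (intro mult_left_mono IH) auto
      also have "\<dots> = ?c"
        by (simp add: std_normal_density_def field_simps flip: exp_add)
      finally show ?thesis
        using False \<open>\<bar>y\<bar> \<le> sqrt t\<close> by (simp add: abs_le_iff ennreal_leI flip: ennreal_mult)
    qed
  qed
  also have "\<dots> = (\<integral>\<^sup>+y. ennreal (std_normal_density y) * indicator {y. t \<le> y\<^sup>2} y \<partial>lborel)
      + ennreal ?c * ennreal (2 * sqrt t)"
    using \<open>t > 0\<close> by (subst nn_integral_add) (auto simp: nn_integral_cmult)
  also have "\<dots> \<le> ennreal (sqrt (2 / pi) * t powr (-1/2) * exp (- t / 2)) + ennreal ?c * ennreal (2 * sqrt t)"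
    by (intro add_right_mono nn_integral_std_normal_tail_le \<open>t > 0\<close>)
  also have "\<dots> = ennreal (sqrt (2 / pi) * t powr (-1/2) * exp (- t / 2) + ?c * (2 * sqrt t))"
    using assms(3,4) by (simp flip: ennreal_mult ennreal_plus)
  also have "sqrt (2 / pi) * t powr (-1/2) * exp (- t / 2) + ?c * (2 * sqrt t)
      = sqrt (2 / pi) * (t powr (-1/2) + K * sqrt t) * exp (- t / 2)"
  proof -
    have "2 / sqrt (2 * pi) = sqrt (2 / pi)"
      by (simp add: real_sqrt_mult real_sqrt_divide real_div_sqrt field_simps)
    then have "?c * (2 * sqrt t) = sqrt (2 / pi) * K * sqrt t * exp (- t / 2)"
      by (simp add: field_simps)
    then show ?thesis by (simp add: algebra_simps)
  qed
  finally show ?thesis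
    using assms(3,4) by (simp add: ennreal_le_iff)
qed

text \<open>Induction from two degrees of freedom. Up to the factor \<open>exp (- t / 2)\<close>, a
  new coordinate multiplies the bound by at most \<open>sqrt t\<close> and adds at most 1, which the
  growth of \<open>2 * (n + 1)\<close> absorbs. The maximum with 1 covers \<open>t < 1\<close>,
  where the bound exceeds 1.\<close>

lemma chi_square_tail_le:
  assumes "card I = Suc (Suc n)" "t \<ge> 0"
  shows "chi_square_tail I t \<le> 2 * (real n + 1) * max 1 (sqrt t) ^ n * exp (- t / 2)"
  using assms
proof (induction n arbitrary: I t)
  case 0
  then show ?case by (simp add: chi_square_tail_2)
next
  case (Suc n)
  obtain i J where I: "I = insert i J" "i \<notin> J" "card J = Suc (Suc n)"
    using Suc.prems(1) by (metis card_Suc_eq)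
  have J: "finite J" using I(3) by (simp add: card_ge_0_finite)
  interpret G: prob_space "gaussian_vector I 1"
    by (intro prob_space_gaussian_vector) simp
  show ?case
  proof (cases "t \<ge> 1")
    case True
    define m where "m = sqrt t"
    have m: "m \<ge> 1" using True by (simp add: m_def)
    \<comment> \<open>The power is frozen at its value for \<open>t\<close>, which dominates
      \<open>max 1 (sqrt u) ^ n\<close> for every \<open>u \<le> t\<close>; this makes
      \<open>K\<close> independent of \<open>u\<close>.\<close>
    define K where "K = 2 * (real n + 1) * m ^ n"
    have K: "K \<ge> 0" using m by (simp add: K_def)
    have "chi_square_tail I t \<le> sqrt (2 / pi) * (t powr (-1/2) + K * m) * exp (- t / 2)"
      unfolding I(1) m_def
    proof (rule chi_square_tail_insert[OF J I(2) _ K])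
      fix u assume u: "0 \<le> u" "u \<le> t"
      have "max 1 (sqrt u) ^ n \<le> m ^ n"
        using u m by (intro power_mono) (auto simp: m_def)
      then have "2 * (real n + 1) * max 1 (sqrt u) ^ n * exp (- u / 2) \<le> K * exp (- u / 2)"
        unfolding K_def by (intro mult_right_mono mult_left_mono) auto
      then show "chi_square_tail J u \<le> K * exp (- u / 2)"
        using Suc.IH[OF I(3) u(1)] by linarith
    qed (use True in auto)
    also have "\<dots> \<le> 1 * (1 + K * m) * exp (- t / 2)"
      using True K m pi_gt3
      by (intro mult_right_mono mult_mono add_right_mono) (auto intro!: powr_le_one_le simp: powr_minus_divide ge_one_powr_ge_zero)
    also have "1 * (1 + K * m) \<le> 2 * (real (Suc n) + 1) * m ^ Suc n"
      using one_le_power[OF m, of "Suc n"] by (simp add: K_def algebra_simps)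
    also have "m = max 1 (sqrt t)" using m by (simp add: m_def)
    finally show ?thesis by simp
  next
    case False
    \<comment> \<open>For \<open>t < 1\<close> the exponential is at least 1/2, so the claimed bound
      is at least 1 and any probability satisfies it.\<close>
    have "1 - t / 2 \<le> exp (- t / 2)" using exp_ge_add_one_self[of "- t / 2"] by simp
    then have "1 \<le> 2 * 1 * 1 * exp (- t / 2)" using False by simp
    also have "\<dots> \<le> 2 * (real (Suc n) + 1) * max 1 (sqrt t) ^ Suc n * exp (- t / 2)"
      by (intro mult_right_mono mult_mono one_le_power) auto
    finally show ?thesis using G.prob_le_1 order_trans by blast
  qed
qed

text \<open>Brings all dimensions to one form: \<open>d = 1\<close> rests on
  \<open>sqrt (2 / pi) < 0.8\<close>, and \<open>d \<ge> 2\<close> on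
  \<open>2 * (d - 1) < 0.8 * d\<^sup>2\<close>. Both are strict, whence the strict probability
  bound.\<close>

lemma chi_square_tail_less:
  assumes "card I = d" "d \<ge> 1" "t \<ge> 1"
  shows "chi_square_tail I t < 0.8 * (real d)\<^sup>2 * t powr (real d / 2 - 1) * exp (- t / 2)"
proof (cases "d = 1")
  case True
  have "chi_square_tail I t \<le> sqrt (2 / pi) * t powr (-1/2) * exp (- t / 2)"
    using assms True by (intro chi_square_tail_1) auto
  also have "\<dots> < 0.8 * t powr (-1/2) * exp (- t / 2)"
    using assms(3) sqrt_two_over_pi_less by (intro mult_strict_right_mono) auto
  finally show ?thesis using True by simp
next
  case False
  then obtain n where d: "d = Suc (Suc n)"
    using assms(2) by (metis One_nat_def Suc_le_D not0_implies_Suc)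
  have "chi_square_tail I t \<le> 2 * (real n + 1) * max 1 (sqrt t) ^ n * exp (- t / 2)"
    using assms d by (intro chi_square_tail_le) auto
  also have "max 1 (sqrt t) ^ n = t powr (real d / 2 - 1)"
  proof -
    have "max 1 (sqrt t) = t powr (1/2)" using assms(3) by (simp add: powr_half_sqrt)
    moreover have "(t powr (1/2)) ^ n = t powr (real d / 2 - 1)"
      using assms(3) by (subst powr_power) (auto simp: d add_divide_distrib)
    ultimately show ?thesis by simp
  qed
  also have "2 * (real n + 1) * t powr (real d / 2 - 1) * exp (- t / 2)
      < 0.8 * (real d)\<^sup>2 * t powr (real d / 2 - 1) * exp (- t / 2)"
  proof (intro mult_strict_right_mono)
    \<comment> \<open>Completing the square in \<open>d\<close>, with
      \<open>n + 1 = d - 1\<close>.\<close>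
    have eq: "0.8 * (real d)\<^sup>2 - 2 * (real n + 1) = 0.8 * (real d - 1.25)\<^sup>2 + 0.75"
      by (simp add: d power2_eq_square algebra_simps)
    have "0 < 0.8 * (real d - 1.25)\<^sup>2 + (0.75 :: real)"
      by (intro add_nonneg_pos) auto
    then show "2 * (real n + 1) < 0.8 * (real d)\<^sup>2"
      unfolding eq[symmetric] by (simp only: diff_gt_0_iff_gt)
  qed (use assms(3) in auto)
  finally show ?thesis .
qed

subsection \<open>Block-coherence estimates\<close>

lemma finite_blk [simp]: "finite (blk d i)"
  by (simp add: blk_def)

lemma card_blk [simp]: "card (blk d i) = d"
  by (simp add: blk_def)

lemma bnorm_L2_set: "bnorm d v i = L2_set v (blk d i)"
  by (simp add: bnorm_def L2_set_def)

lemma bnorm_nonneg [simp]: "0 \<le> bnorm d v i"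
  by (simp add: bnorm_L2_set)

lemma bnorm_square: "(bnorm d v i)\<^sup>2 = (\<Sum>j\<in>blk d i. (v j)\<^sup>2)"
  by (simp add: bnorm_def sum_nonneg)

lemma sum_blocks: "(\<Sum>j<M * d. f j) = (\<Sum>i<M. \<Sum>j\<in>blk d i. f j)"
  unfolding blk_def using sum.nat_group[of f d M, symmetric] by (simp add: add.commute)

lemma blk_less: "j \<in> blk d i \<Longrightarrow> i < M \<Longrightarrow> j < M * d"
proof -
  assume "j \<in> blk d i" "i < M"
  then have "j < (i + 1) * d" "(i + 1) * d \<le> M * d"
    by (auto simp: blk_def simp del: add_mult_distrib mult_Suc intro!: mult_le_mono1)
  then show ?thesis by simp
qed

lemma blk_disjoint: "j \<in> blk d i \<Longrightarrow> j \<in> blk d l \<Longrightarrow> i = l"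
proof -
  have "j div d = i" if "j \<in> blk d i" for i
    using that by (intro div_nat_eqI) (auto simp: blk_def mult.commute)
  then show "j \<in> blk d i \<Longrightarrow> j \<in> blk d l \<Longrightarrow> i = l" by blast
qed

section \<open>Norm inequalities and the coherence constants as operator bounds\<close>

lemma L2_set_sum_le: "L2_set (\<lambda>a. \<Sum>l\<in>K. f l a) A \<le> (\<Sum>l\<in>K. L2_set (f l) A)"
proof (induction K rule: infinite_finite_induct)
  case (insert l K)
  have "L2_set (\<lambda>a. f l a + (\<Sum>l\<in>K. f l a)) A \<le> L2_set (f l) A + L2_set (\<lambda>a. \<Sum>l\<in>K. f l a) A"
    by (rule L2_set_triangle_ineq)
  with insert show ?case by simp
qed (simp_all add: L2_set_def)

lemma L2_set_scale: "L2_set (\<lambda>a. c * f a) A = \<bar>c\<bar> * L2_set f A"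
  by (simp add: L2_set_def power_mult_distrib sum_distrib_left[symmetric] real_sqrt_mult)

lemma L2_set_mult_le: "\<bar>\<Sum>i\<in>A. f i * g i\<bar> \<le> L2_set f A * L2_set g A"
proof -
  have "\<bar>\<Sum>i\<in>A. f i * g i\<bar> \<le> (\<Sum>i\<in>A. \<bar>f i\<bar> * \<bar>g i\<bar>)"
    using sum_abs[of "\<lambda>i. f i * g i" A] by (simp add: abs_mult)
  also have "\<dots> \<le> L2_set f A * L2_set g A" by (rule L2_set_mult_ineq)
  finally show ?thesis .
qed

text \<open>A crude bound whose purpose is to show that the set under the supremum in
  \<open>cross_specnorm\<close> is bounded above.\<close>

lemma L2_set_matvec_le:
  "L2_set (\<lambda>a. \<Sum>b\<in>B. G a b * u b) A \<le> (\<Sum>a\<in>A. L2_set (G a) B) * L2_set u B"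
proof -
  have "L2_set (\<lambda>a. \<Sum>b\<in>B. G a b * u b) A \<le> (\<Sum>a\<in>A. \<bar>\<Sum>b\<in>B. G a b * u b\<bar>)"
    by (rule L2_set_le_sum_abs)
  also have "\<dots> \<le> (\<Sum>a\<in>A. L2_set (G a) B * L2_set u B)"
    by (intro sum_mono L2_set_mult_le)
  finally show ?thesis by (simp add: sum_distrib_right)
qed

text \<open>Rescale \<open>v\<close> to unit norm on block \<open>l\<close> and use homogeneity; if
  \<open>v\<close> vanishes on the block, both sides are 0.\<close>

lemma cross_specnorm_bound:
  "L2_set (\<lambda>a. \<Sum>b\<in>blk d l. col_inner L D a b * v b) (blk d i)
    \<le> cross_specnorm L d D i l * bnorm d v l"
proof (cases "bnorm d v l = 0")
  case True
  then have "\<forall>b\<in>blk d l. v b = 0" by (simp add: bnorm_L2_set L2_set_eq_0_iff)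
  then show ?thesis using True by (simp add: L2_set_def)
next
  case False
  define r where "r = bnorm d v l"
  have r: "r > 0" using False bnorm_nonneg[of d v l] unfolding r_def by linarith
  let ?G = "col_inner L D"
  let ?X = "{sqrt (\<Sum>a\<in>blk d i. (\<Sum>b\<in>blk d l. ?G a b * u b)\<^sup>2) | u. (\<Sum>b\<in>blk d l. (u b)\<^sup>2) \<le> 1}"
  have bdd: "bdd_above ?X"
  proof (rule bdd_aboveI)
    fix y assume "y \<in> ?X"
    then obtain u where u: "(\<Sum>b\<in>blk d l. (u b)\<^sup>2) \<le> 1"
      and y: "y = L2_set (\<lambda>a. \<Sum>b\<in>blk d l. ?G a b * u b) (blk d i)"
      by (auto simp: L2_set_def)
    have "y \<le> (\<Sum>a\<in>blk d i. L2_set (?G a) (blk d l)) * L2_set u (blk d l)"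
      unfolding y by (rule L2_set_matvec_le)
    also have "\<dots> \<le> (\<Sum>a\<in>blk d i. L2_set (?G a) (blk d l)) * 1"
      using u by (intro mult_left_mono sum_nonneg L2_set_nonneg) (simp add: L2_set_def)
    finally show "y \<le> (\<Sum>a\<in>blk d i. L2_set (?G a) (blk d l)) * 1" .
  qed
  define u where "u = (\<lambda>b. (1 / r) * v b)"
  have "L2_set u (blk d l) = 1"
    unfolding u_def L2_set_scale using r by (simp add: r_def bnorm_L2_set)
  then have "(\<Sum>b\<in>blk d l. (u b)\<^sup>2) \<le> 1" by (simp add: L2_set_def)
  then have "L2_set (\<lambda>a. \<Sum>b\<in>blk d l. ?G a b * u b) (blk d i) \<le> cross_specnorm L d D i l"
    unfolding cross_specnorm_def by (intro cSup_upper[OF _ bdd]) (auto simp: L2_set_def)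
  moreover have "(\<Sum>b\<in>blk d l. ?G a b * u b) = (1 / r) * (\<Sum>b\<in>blk d l. ?G a b * v b)" for a
    by (simp add: u_def sum_distrib_left mult_ac)
  ultimately have "\<bar>1 / r\<bar> * L2_set (\<lambda>a. \<Sum>b\<in>blk d l. ?G a b * v b) (blk d i)
      \<le> cross_specnorm L d D i l"
    unfolding L2_set_scale[symmetric] by (simp only:)
  then show ?thesis
    using r by (simp add: pos_divide_le_eq flip: r_def)
qed

lemma finite_block_coherence_set:
  "finite {cross_specnorm L d D i j / real d | i j. i < M \<and> j < M \<and> i \<noteq> j}"
proof (rule finite_subset)
  show "{cross_specnorm L d D i j / real d | i j. i < M \<and> j < M \<and> i \<noteq> j}
      \<subseteq> (\<lambda>(i, j). cross_specnorm L d D i j / real d) ` ({..<M} \<times> {..<M})"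
    by auto
qed simp

lemma block_coherence_bound:
  assumes "i < M" "l < M" "i \<noteq> l" "d > 0"
  shows "L2_set (\<lambda>a. \<Sum>b\<in>blk d l. col_inner L D a b * v b) (blk d i)
    \<le> real d * block_coherence L M d D * bnorm d v l"
proof -
  have "cross_specnorm L d D i l / real d \<le> block_coherence L M d D"
    unfolding block_coherence_def using assms
    by (intro Max_ge finite.insertI finite_block_coherence_set) auto
  then have "cross_specnorm L d D i l \<le> real d * block_coherence L M d D"
    using assms(4) by (simp add: field_simps)
  then have "cross_specnorm L d D i l * bnorm d v l \<le> real d * block_coherence L M d D * bnorm d v l"
    by (intro mult_right_mono) auto
  with cross_specnorm_bound show ?thesis by (rule order_trans)
qed

lemma block_coherence_nonneg: "0 \<le> block_coherence L M d D"
  unfolding block_coherence_def by (intro Max_ge finite.insertI finite_block_coherence_set) simp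

lemma finite_sub_coherence_set:
  "finite {\<bar>col_inner L D a b\<bar> | a b l. l < M \<and> a \<in> blk d l \<and> b \<in> blk d l \<and> a \<noteq> b}"
proof (rule finite_subset)
  show "{\<bar>col_inner L D a b\<bar> | a b l. l < M \<and> a \<in> blk d l \<and> b \<in> blk d l \<and> a \<noteq> b}
      \<subseteq> (\<lambda>(a, b). \<bar>col_inner L D a b\<bar>) ` ({..<M * d} \<times> {..<M * d})"
    by (auto dest: blk_less)
qed simp

lemma sub_coherence_nonneg: "0 \<le> sub_coherence L M d D"
  unfolding sub_coherence_def by (intro Max_ge finite.insertI finite_sub_coherence_set) simp

lemma col_inner_le_sub_coherence:
  assumes "l < M" "a \<in> blk d l" "b \<in> blk d l" "a \<noteq> b"
  shows "\<bar>col_inner L D a b\<bar> \<le> sub_coherence L M d D"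
  unfolding sub_coherence_def using assms
  by (intro Max_ge finite.insertI finite_sub_coherence_set) auto

text \<open>Each row has \<open>card B - 1\<close> off-diagonal entries, so Cauchy-Schwarz costs one
  factor \<open>card B - 1\<close>; summing over rows costs another, and the square root leaves
  one.\<close>

lemma L2_set_offdiag_le:
  assumes "finite B" "c \<ge> 0" and "\<And>a b. a \<in> B \<Longrightarrow> b \<in> B \<Longrightarrow> a \<noteq> b \<Longrightarrow> \<bar>G a b\<bar> \<le> c"
  shows "L2_set (\<lambda>a. \<Sum>b\<in>B - {a}. G a b * v b) B \<le> (real (card B) - 1) * c * L2_set v B"
proof (cases "B = {}")
  case False
  then have card: "real (card B) \<ge> 1" using assms(1) by (simp add: Suc_le_eq card_gt_0_iff)
  have 1: "(\<Sum>b\<in>B - {a}. G a b * v b)\<^sup>2 \<le> c\<^sup>2 * ((real (card B) - 1) * (\<Sum>b\<in>B - {a}. (v b)\<^sup>2))"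
    if a: "a \<in> B" for a
  proof -
    have "\<bar>\<Sum>b\<in>B - {a}. G a b * v b\<bar> \<le> (\<Sum>b\<in>B - {a}. \<bar>G a b * v b\<bar>)" by (rule sum_abs)
    also have "\<dots> \<le> (\<Sum>b\<in>B - {a}. c * \<bar>v b\<bar>)"
      using a assms(3) by (intro sum_mono) (auto simp: abs_mult intro!: mult_right_mono)
    also have "\<dots> = c * \<bar>\<Sum>b\<in>B - {a}. \<bar>v b\<bar>\<bar>"
      by (simp add: sum_distrib_left sum_nonneg)
    finally have "\<bar>\<Sum>b\<in>B - {a}. G a b * v b\<bar>\<^sup>2 \<le> (c * \<bar>\<Sum>b\<in>B - {a}. \<bar>v b\<bar>\<bar>)\<^sup>2"
      by (rule power_mono) simp
    also have "\<dots> = c\<^sup>2 * (\<Sum>b\<in>B - {a}. 1 * \<bar>v b\<bar>)\<^sup>2"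
      by (simp add: power_mult_distrib)
    also have "\<dots> \<le> c\<^sup>2 * ((\<Sum>b\<in>B - {a}. 1\<^sup>2) * (\<Sum>b\<in>B - {a}. \<bar>v b\<bar>\<^sup>2))"
      by (intro mult_left_mono Cauchy_Schwarz_ineq_sum) auto
    also have "(\<Sum>b\<in>B - {a}. 1\<^sup>2 :: real) = real (card B) - 1"
      using a assms(1) card by (simp add: card_Diff_singleton of_nat_diff)
    finally show ?thesis by simp
  qed
  have "(\<Sum>a\<in>B. (\<Sum>b\<in>B - {a}. G a b * v b)\<^sup>2)
      \<le> (\<Sum>a\<in>B. c\<^sup>2 * ((real (card B) - 1) * (\<Sum>b\<in>B - {a}. (v b)\<^sup>2)))"
    by (intro sum_mono 1)
  \<comment> \<open>Every \<open>(v b)\<^sup>2\<close> occurs in all rows except its own.\<close>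
  also have "\<dots> = c\<^sup>2 * ((real (card B) - 1) * (\<Sum>a\<in>B. (\<Sum>b\<in>B. (v b)\<^sup>2) - (v a)\<^sup>2))"
    using assms(1) by (simp add: sum_distrib_left sum_diff1)
  also have "\<dots> = ((real (card B) - 1) * c)\<^sup>2 * (\<Sum>b\<in>B. (v b)\<^sup>2)"
    by (simp add: sum_subtractf power2_eq_square algebra_simps)
  finally have "sqrt (\<Sum>a\<in>B. (\<Sum>b\<in>B - {a}. G a b * v b)\<^sup>2)
      \<le> sqrt (((real (card B) - 1) * c)\<^sup>2 * (\<Sum>b\<in>B. (v b)\<^sup>2))"
    by (rule real_sqrt_le_mono)
  then show ?thesis
    using card assms(2) by (simp add: L2_set_def real_sqrt_mult)
qed simp

section \<open>Gram matrix of the dictionary, block by block\<close>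

context
  fixes L M d :: nat and D :: "nat \<Rightarrow> nat \<Rightarrow> real"
  assumes d_pos: "d > 0" and unit_cols: "\<forall>j<M * d. (\<Sum>r<L. (D r j)\<^sup>2) = 1"
begin

private abbreviation (input) "G \<equiv> col_inner L D"
private abbreviation (input) "\<nu> \<equiv> sub_coherence L M d D"
private abbreviation (input) "\<mu>B \<equiv> block_coherence L M d D"

text \<open>Unit columns put 1 on the diagonal of the Gram block, so its difference from the
  identity is the off-diagonal part, with entries bounded by \<nu>.\<close>

lemma gram_block_deviation:
  assumes "i < M"
  shows "L2_set (\<lambda>a. (\<Sum>b\<in>blk d i. G a b * v b) - v a) (blk d i) \<le> (real d - 1) * \<nu> * bnorm d v i"
proof -
  have "(\<Sum>b\<in>blk d i. G a b * v b) - v a = (\<Sum>b\<in>blk d i - {a}. G a b * v b)" if "a \<in> blk d i" for a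
  proof -
    have "G a a = 1"
      using unit_cols blk_less[OF that assms] by (simp add: col_inner_def power2_eq_square)
    then show ?thesis using that by (simp add: sum.remove[of "blk d i" a])
  qed
  then have "L2_set (\<lambda>a. (\<Sum>b\<in>blk d i. G a b * v b) - v a) (blk d i)
      = L2_set (\<lambda>a. \<Sum>b\<in>blk d i - {a}. G a b * v b) (blk d i)"
    by (intro L2_set_cong) auto
  also have "\<dots> \<le> (real (card (blk d i)) - 1) * \<nu> * L2_set v (blk d i)"
    by (intro L2_set_offdiag_le sub_coherence_nonneg col_inner_le_sub_coherence[OF assms]) auto
  finally show ?thesis by (simp add: bnorm_L2_set)
qed

text \<open>Cauchy-Schwarz for \<open>v\<close> against the deviation from the identity. The upper
  half bounds the operator norm of a block, the lower half enters
  \<open>gram_lower_bound\<close>.\<close>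

lemma gram_block_quadratic_form:
  assumes "i < M"
  shows "\<bar>(\<Sum>a\<in>blk d i. v a * (\<Sum>b\<in>blk d i. G a b * v b)) - (bnorm d v i)\<^sup>2\<bar>
    \<le> (real d - 1) * \<nu> * (bnorm d v i)\<^sup>2"
proof -
  have "\<bar>(\<Sum>a\<in>blk d i. v a * (\<Sum>b\<in>blk d i. G a b * v b)) - (bnorm d v i)\<^sup>2\<bar>
      = \<bar>\<Sum>a\<in>blk d i. v a * ((\<Sum>b\<in>blk d i. G a b * v b) - v a)\<bar>"
    unfolding bnorm_square by (simp add: sum_subtractf right_diff_distrib power2_eq_square)
  also have "\<dots> \<le> bnorm d v i * L2_set (\<lambda>a. (\<Sum>b\<in>blk d i. G a b * v b) - v a) (blk d i)"
    unfolding bnorm_L2_set by (rule L2_set_mult_le)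
  also have "\<dots> \<le> bnorm d v i * ((real d - 1) * \<nu> * bnorm d v i)"
    by (intro mult_left_mono gram_block_deviation assms) simp
  finally show ?thesis by (simp add: power2_eq_square mult_ac)
qed

text \<open>The left side is the quadratic form of the Gram block, after moving the sum over rows
  inside. It provides the constant \<open>c\<close> of
  \<open>gaussian_tail_le_chi_square\<close>.\<close>

lemma block_operator_norm_le:
  assumes "i < M"
  shows "(\<Sum>r<L. (\<Sum>a\<in>blk d i. D r a * g a)\<^sup>2) \<le> (1 + (real d - 1) * \<nu>) * (\<Sum>a\<in>blk d i. (g a)\<^sup>2)"
proof -
  have "(\<Sum>r<L. (\<Sum>a\<in>blk d i. D r a * g a)\<^sup>2)
      = (\<Sum>r<L. \<Sum>a\<in>blk d i. \<Sum>b\<in>blk d i. g a * (D r a * D r b * g b))"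
    by (simp add: power2_eq_square sum_product mult_ac)
  also have "\<dots> = (\<Sum>a\<in>blk d i. \<Sum>b\<in>blk d i. \<Sum>r<L. g a * (D r a * D r b * g b))"
    by (subst sum.swap, rule sum.cong[OF refl], rule sum.swap)
  also have "\<dots> = (\<Sum>a\<in>blk d i. g a * (\<Sum>b\<in>blk d i. G a b * g b))"
    by (simp add: col_inner_def sum_distrib_left sum_distrib_right)
  also have "\<dots> \<le> (1 + (real d - 1) * \<nu>) * (bnorm d g i)\<^sup>2"
    using gram_block_quadratic_form[OF assms, of g] by (simp add: algebra_simps abs_le_iff)
  finally show ?thesis by (simp add: bnorm_square)
qed

lemma correlation_decomp:
  "(\<Sum>r<L. D r a * matvec (M * d) D v r) = (\<Sum>l<M. \<Sum>b\<in>blk d l. G a b * v b)"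
proof -
  have "(\<Sum>r<L. D r a * matvec (M * d) D v r) = (\<Sum>b<M * d. G a b * v b)"
    unfolding matvec_def col_inner_def
    by (simp add: sum_distrib_left sum_distrib_right mult_ac, subst sum.swap, rule refl)
  then show ?thesis by (simp add: sum_blocks)
qed

text \<open>Block version of Gershgorin: diagonal blocks contribute at least
  \<open>1 - (d - 1) * \<nu>\<close>, each ordered pair of distinct blocks at least
  \<open>- d * \<mu>B\<close> times the product of its block norms, and these products sum to at
  most \<open>k - 1\<close> times the total square.\<close>

lemma gram_lower_bound:
  assumes Sh: "Sh \<subseteq> {..<M}" "card Sh = k"
    and supp: "\<And>i. i < M \<Longrightarrow> i \<notin> Sh \<Longrightarrow> bnorm d e i = 0"
  shows "(1 - (real d - 1) * \<nu> - (real k - 1) * real d * \<mu>B) * (\<Sum>i\<in>Sh. (bnorm d e i)\<^sup>2)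
    \<le> (\<Sum>a<M * d. e a * (\<Sum>r<L. D r a * matvec (M * d) D e r))"
proof -
  have fin: "finite Sh" using Sh(1) finite_subset by blast
  have e0: "e b = 0" if "i < M" "i \<notin> Sh" "b \<in> blk d i" for i b
    using supp[OF that(1,2)] that(3) by (simp add: bnorm_L2_set L2_set_eq_0_iff)
  let ?c = "\<lambda>i l a. \<Sum>b\<in>blk d l. G a b * e b"
  have "(\<Sum>a<M * d. e a * (\<Sum>r<L. D r a * matvec (M * d) D e r))
      = (\<Sum>i<M. \<Sum>a\<in>blk d i. e a * (\<Sum>l<M. ?c i l a))"
    by (simp add: correlation_decomp sum_blocks)
  also have "\<dots> = (\<Sum>i\<in>Sh. \<Sum>a\<in>blk d i. e a * (\<Sum>l\<in>Sh. ?c i l a))"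
  proof -
    have "(\<Sum>l<M. ?c i l a) = (\<Sum>l\<in>Sh. ?c i l a)" for i a
      using Sh(1) e0 by (intro sum.mono_neutral_right) auto
    moreover have "(\<Sum>i<M. \<Sum>a\<in>blk d i. e a * (\<Sum>l\<in>Sh. ?c i l a))
        = (\<Sum>i\<in>Sh. \<Sum>a\<in>blk d i. e a * (\<Sum>l\<in>Sh. ?c i l a))"
      using Sh(1) e0 by (intro sum.mono_neutral_right) auto
    ultimately show ?thesis by simp
  qed
  also have "\<dots> = (\<Sum>i\<in>Sh. (\<Sum>a\<in>blk d i. e a * ?c i i a)
      + (\<Sum>l\<in>Sh - {i}. \<Sum>a\<in>blk d i. e a * ?c i l a))"
  proof (intro sum.cong refl)
    fix i assume i: "i \<in> Sh"
    have "(\<Sum>a\<in>blk d i. e a * (\<Sum>l\<in>Sh - {i}. ?c i l a)) = (\<Sum>l\<in>Sh - {i}. \<Sum>a\<in>blk d i. e a * ?c i l a)"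
      unfolding sum_distrib_left[of _ _ "Sh - {i}"] by (rule sum.swap)
    then show "(\<Sum>a\<in>blk d i. e a * (\<Sum>l\<in>Sh. ?c i l a))
      = (\<Sum>a\<in>blk d i. e a * ?c i i a) + (\<Sum>l\<in>Sh - {i}. \<Sum>a\<in>blk d i. e a * ?c i l a)"
      unfolding sum.remove[OF fin i, of "\<lambda>l. ?c i l _"] distrib_left sum.distrib by simp
  qed
  finally have eq: "(\<Sum>a<M * d. e a * (\<Sum>r<L. D r a * matvec (M * d) D e r))
      = (\<Sum>i\<in>Sh. (\<Sum>a\<in>blk d i. e a * ?c i i a) + (\<Sum>l\<in>Sh - {i}. \<Sum>a\<in>blk d i. e a * ?c i l a))" .
  have lower: "(\<Sum>a\<in>blk d i. e a * ?c i i a) + (\<Sum>l\<in>Sh - {i}. \<Sum>a\<in>blk d i. e a * ?c i l a)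
      \<ge> (1 - (real d - 1) * \<nu>) * (bnorm d e i)\<^sup>2
        - real d * \<mu>B * (bnorm d e i * (\<Sum>l\<in>Sh - {i}. bnorm d e l))" if i: "i \<in> Sh" for i
  proof -
    have iM: "i < M" using i Sh(1) by auto
    have "\<bar>\<Sum>a\<in>blk d i. e a * ?c i l a\<bar> \<le> real d * \<mu>B * (bnorm d e i * bnorm d e l)"
      if l: "l \<in> Sh - {i}" for l
    proof -
      have "\<bar>\<Sum>a\<in>blk d i. e a * ?c i l a\<bar> \<le> bnorm d e i * L2_set (?c i l) (blk d i)"
        unfolding bnorm_L2_set by (rule L2_set_mult_le)
      also have "\<dots> \<le> bnorm d e i * (real d * \<mu>B * bnorm d e l)"
        using l iM Sh(1) d_pos by (intro mult_left_mono block_coherence_bound) auto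
      finally show ?thesis by (simp add: mult_ac)
    qed
    then have "- (\<Sum>l\<in>Sh - {i}. \<Sum>a\<in>blk d i. e a * ?c i l a)
        \<le> (\<Sum>l\<in>Sh - {i}. real d * \<mu>B * (bnorm d e i * bnorm d e l))"
      unfolding sum_negf[of _ "Sh - {i}", symmetric] by (intro sum_mono order_trans[OF abs_ge_minus_self]) simp
    then show ?thesis
      using gram_block_quadratic_form[OF iM, of e] by (simp add: sum_distrib_left abs_le_iff algebra_simps)
  qed
  \<comment> \<open>The left side is the square of the sum minus the sum of squares; Cauchy-Schwarz
    bounds the former by \<open>k\<close> times the latter.\<close>
  have off: "(\<Sum>i\<in>Sh. bnorm d e i * (\<Sum>l\<in>Sh - {i}. bnorm d e l)) \<le> (real k - 1) * (\<Sum>i\<in>Sh. (bnorm d e i)\<^sup>2)"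
  proof -
    have "(\<Sum>i\<in>Sh. bnorm d e i * (\<Sum>l\<in>Sh - {i}. bnorm d e l))
        = (\<Sum>i\<in>Sh. bnorm d e i)\<^sup>2 - (\<Sum>i\<in>Sh. (bnorm d e i)\<^sup>2)"
      using fin by (simp add: sum_diff1 right_diff_distrib sum_subtractf power2_eq_square sum_distrib_right)
    moreover have "(\<Sum>i\<in>Sh. 1 * bnorm d e i)\<^sup>2 \<le> (\<Sum>i\<in>Sh. 1\<^sup>2) * (\<Sum>i\<in>Sh. (bnorm d e i)\<^sup>2)"
      by (rule Cauchy_Schwarz_ineq_sum)
    ultimately show ?thesis using Sh(2) by (simp add: algebra_simps)
  qed
  have "(1 - (real d - 1) * \<nu> - (real k - 1) * real d * \<mu>B) * (\<Sum>i\<in>Sh. (bnorm d e i)\<^sup>2)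
      = (1 - (real d - 1) * \<nu>) * (\<Sum>i\<in>Sh. (bnorm d e i)\<^sup>2)
        - real d * \<mu>B * ((real k - 1) * (\<Sum>i\<in>Sh. (bnorm d e i)\<^sup>2))"
    by (simp add: algebra_simps)
  also have "\<dots> \<le> (1 - (real d - 1) * \<nu>) * (\<Sum>i\<in>Sh. (bnorm d e i)\<^sup>2)
        - real d * \<mu>B * (\<Sum>i\<in>Sh. bnorm d e i * (\<Sum>l\<in>Sh - {i}. bnorm d e l))"
    using block_coherence_nonneg by (intro diff_left_mono mult_left_mono off) auto
  also have "\<dots> = (\<Sum>i\<in>Sh. (1 - (real d - 1) * \<nu>) * (bnorm d e i)\<^sup>2
        - real d * \<mu>B * (bnorm d e i * (\<Sum>l\<in>Sh - {i}. bnorm d e l)))"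
    by (simp only: sum_subtractf sum_distrib_left)
  also have "\<dots> \<le> (\<Sum>a<M * d. e a * (\<Sum>r<L. D r a * matvec (M * d) D e r))"
    unfolding eq by (intro sum_mono lower)
  finally show ?thesis .
qed

lemma interference_le:
  assumes "i < M" "K \<subseteq> {..<M} - {i}" "\<And>l. l \<in> K \<Longrightarrow> bnorm d v l \<le> X"
  shows "L2_set (\<lambda>a. \<Sum>l\<in>K. \<Sum>b\<in>blk d l. G a b * v b) (blk d i)
    \<le> real (card K) * (real d * \<mu>B * X)"
proof -
  have "L2_set (\<lambda>a. \<Sum>l\<in>K. \<Sum>b\<in>blk d l. G a b * v b) (blk d i)
      \<le> (\<Sum>l\<in>K. L2_set (\<lambda>a. \<Sum>b\<in>blk d l. G a b * v b) (blk d i))"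
    by (rule L2_set_sum_le)
  also have "\<dots> \<le> (\<Sum>l\<in>K. real d * \<mu>B * X)"
  proof (intro sum_mono)
    fix l assume l: "l \<in> K"
    have "L2_set (\<lambda>a. \<Sum>b\<in>blk d l. G a b * v b) (blk d i) \<le> real d * \<mu>B * bnorm d v l"
      using l assms(1,2) d_pos by (intro block_coherence_bound) auto
    also have "\<dots> \<le> real d * \<mu>B * X"
      using l assms(3) block_coherence_nonneg by (intro mult_left_mono) auto
    finally show "L2_set (\<lambda>a. \<Sum>b\<in>blk d l. G a b * v b) (blk d i) \<le> real d * \<mu>B * X" .
  qed
  finally show ?thesis by simp
qed

section \<open>Deterministic analysis of selection and estimation\<close>

lemma correlation_bsupp:
  "(\<Sum>r<L. D r a * matvec (M * d) D x r) = (\<Sum>l\<in>bsupp d M x. \<Sum>b\<in>blk d l. G a b * x b)"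
  unfolding correlation_decomp
  by (intro sum.mono_neutral_right) (auto simp: bsupp_def)

lemma rho_noisy:
  "rho L d D (\<lambda>r. matvec (M * d) D x r + w r) i
    = L2_set (\<lambda>a. (\<Sum>l\<in>bsupp d M x. \<Sum>b\<in>blk d l. G a b * x b) + (\<Sum>r<L. D r a * w r)) (blk d i)"
  by (simp add: rho_def L2_set_def distrib_left sum.distrib correlation_bsupp)

text \<open>Off the support there is only leakage: at most \<open>k\<close> support blocks, each
  contributing at most \<open>d * \<mu>B * X\<close>, plus the noise.\<close>

lemma rho_outside_less:
  assumes "i < M" "i \<notin> bsupp d M x" "card (bsupp d M x) \<le> k"
    and X: "X \<ge> 0" "\<And>l. l \<in> bsupp d M x \<Longrightarrow> bnorm d x l \<le> X"
    and noise: "L2_set (\<lambda>a. \<Sum>r<L. D r a * w r) (blk d i) < \<tau>"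
  shows "rho L d D (\<lambda>r. matvec (M * d) D x r + w r) i < real k * (real d * \<mu>B * X) + \<tau>"
proof -
  let ?c = "\<lambda>a. \<Sum>l\<in>bsupp d M x. \<Sum>b\<in>blk d l. G a b * x b"
  have "rho L d D (\<lambda>r. matvec (M * d) D x r + w r) i
      \<le> L2_set ?c (blk d i) + L2_set (\<lambda>a. \<Sum>r<L. D r a * w r) (blk d i)"
    unfolding rho_noisy by (rule L2_set_triangle_ineq)
  moreover have "L2_set ?c (blk d i) \<le> real (card (bsupp d M x)) * (real d * \<mu>B * X)"
    using assms(1,2) X(2) by (intro interference_le) (auto simp: bsupp_def)
  moreover have "\<dots> \<le> real k * (real d * \<mu>B * X)"
    using assms(3) X(1) block_coherence_nonneg by (intro mult_right_mono mult_nonneg_nonneg) auto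
  ultimately show ?thesis using noise by linarith
qed

text \<open>Reverse triangle inequality. A support block suffers leakage from at most
  \<open>k - 1\<close> others; together with the \<open>k\<close> of \<open>rho_outside_less\<close>
  this makes the \<open>2 * k - 1\<close> in the gap condition.\<close>

lemma rho_inside_greater:
  assumes i: "i \<in> bsupp d M x" and "card (bsupp d M x) \<le> k"
    and X: "X \<ge> 0" "\<And>l. l \<in> bsupp d M x \<Longrightarrow> bnorm d x l \<le> X"
    and noise: "L2_set (\<lambda>a. \<Sum>r<L. D r a * w r) (blk d i) < \<tau>"
  shows "(1 - (real d - 1) * \<nu>) * bnorm d x i - (real k - 1) * (real d * \<mu>B * X) - \<tau>
    < rho L d D (\<lambda>r. matvec (M * d) D x r + w r) i"
proof -
  have iM: "i < M" using i by (simp add: bsupp_def)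
  have fin: "finite (bsupp d M x)" by (simp add: bsupp_def)
  let ?n = "\<lambda>a. \<Sum>r<L. D r a * w r"
  let ?own = "\<lambda>a. \<Sum>b\<in>blk d i. G a b * x b"
  let ?oth = "\<lambda>a. \<Sum>l\<in>bsupp d M x - {i}. \<Sum>b\<in>blk d l. G a b * x b"
  let ?tot = "\<lambda>a. (\<Sum>l\<in>bsupp d M x. \<Sum>b\<in>blk d l. G a b * x b) + ?n a"
  \<comment> \<open>The signal block is the noisy correlation minus the distortion within the block,
    the leakage from other blocks and the noise.\<close>
  have "bnorm d x i = L2_set (\<lambda>a. ?tot a + ((-1) * (?own a - x a) + ((-1) * ?oth a + (-1) * ?n a))) (blk d i)"
    unfolding bnorm_L2_set using sum.remove[OF fin i, of "\<lambda>l. \<Sum>b\<in>blk d l. G _ b * x b"]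
    by (intro L2_set_cong refl) simp
  also have "\<dots> \<le> L2_set ?tot (blk d i) + (L2_set (\<lambda>a. (-1) * (?own a - x a)) (blk d i)
      + (L2_set (\<lambda>a. (-1) * ?oth a) (blk d i) + L2_set (\<lambda>a. (-1) * ?n a) (blk d i)))"
    by (intro order_trans[OF L2_set_triangle_ineq] add_left_mono order_refl)
  also have "\<dots> = rho L d D (\<lambda>r. matvec (M * d) D x r + w r) i
      + (L2_set (\<lambda>a. ?own a - x a) (blk d i) + (L2_set ?oth (blk d i) + L2_set ?n (blk d i)))"
    unfolding rho_noisy L2_set_scale by simp
  also have "\<dots> < rho L d D (\<lambda>r. matvec (M * d) D x r + w r) i
      + ((real d - 1) * \<nu> * bnorm d x i + ((real k - 1) * (real d * \<mu>B * X) + \<tau>))"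
  proof (intro add_strict_left_mono add_le_less_mono gram_block_deviation iM noise)
    have "L2_set ?oth (blk d i) \<le> real (card (bsupp d M x - {i})) * (real d * \<mu>B * X)"
      using iM X(2) by (intro interference_le) (auto simp: bsupp_def)
    also have "\<dots> \<le> (real k - 1) * (real d * \<mu>B * X)"
    proof (intro mult_right_mono)
      \<comment> \<open>Since \<open>i\<close> lies in the support, the natural subtraction in
        \<open>card - 1\<close> is not truncated.\<close>
      have "card (bsupp d M x) \<ge> 1" using fin i by (auto simp: Suc_le_eq card_gt_0_iff)
      then show "real (card (bsupp d M x - {i})) \<le> real k - 1"
        using i assms(2) by (simp add: card_Diff_singleton of_nat_diff)
    qed (use X(1) block_coherence_nonneg in auto)
    finally show "L2_set ?oth (blk d i) \<le> (real k - 1) * (real d * \<mu>B * X)" .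
  qed
  finally show ?thesis by (simp add: algebra_simps)
qed

text \<open>If a support block \<open>i\<close> were missed, some selected \<open>j\<close> would
  lie off the support. The gap condition then gives \<open>?rho j < ?rho i\<close>, against the
  choice of the largest correlations. \<open>X\<close> and \<open>Y\<close> stand for the extreme
  block norms.\<close>

lemma bth_select_support:
  assumes sel: "bth_select L M d k D (\<lambda>r. matvec (M * d) D x r + w r) Sh"
    and sparse: "card (bsupp d M x) \<le> k"
    and X: "X \<ge> 0" "\<And>l. l \<in> bsupp d M x \<Longrightarrow> bnorm d x l \<le> X"
    and Y: "\<And>l. l \<in> bsupp d M x \<Longrightarrow> Y \<le> bnorm d x l"
    and pos: "0 \<le> 1 - (real d - 1) * \<nu>"
    and gap: "2 * \<tau> \<le> (1 - (real d - 1) * \<nu>) * Y - (2 * real k - 1) * real d * \<mu>B * X"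
    and noise: "\<And>i. i < M \<Longrightarrow> L2_set (\<lambda>a. \<Sum>r<L. D r a * w r) (blk d i) < \<tau>"
  shows "bsupp d M x \<subseteq> Sh"
proof (rule ccontr)
  let ?rho = "rho L d D (\<lambda>r. matvec (M * d) D x r + w r)"
  assume "\<not> bsupp d M x \<subseteq> Sh"
  then obtain i where i: "i \<in> bsupp d M x" "i \<notin> Sh" by blast
  then have iM: "i < M" by (simp add: bsupp_def)
  have Sh: "Sh \<subseteq> {..<M}" "card Sh = k" and
    top: "\<And>i j. i \<in> Sh \<Longrightarrow> j < M \<Longrightarrow> j \<notin> Sh \<Longrightarrow> ?rho j \<le> ?rho i"
    using sel by (auto simp: bth_select_def)
  \<comment> \<open>Counting: the support has at most \<open>k = card Sh\<close> elements, so
    inclusion would force equality, but \<open>i\<close> is missing from \<open>Sh\<close>.\<close>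
  have "\<not> Sh \<subseteq> bsupp d M x"
  proof
    assume sub: "Sh \<subseteq> bsupp d M x"
    have "Sh = bsupp d M x"
      using sub sparse Sh(2) by (intro card_seteq) (auto simp: bsupp_def)
    with i show False by simp
  qed
  then obtain j where j: "j \<in> Sh" "j \<notin> bsupp d M x" by blast
  then have jM: "j < M" using Sh(1) by auto
  have "(1 - (real d - 1) * \<nu>) * Y \<le> (1 - (real d - 1) * \<nu>) * bnorm d x i"
    by (intro mult_left_mono Y i pos)
  then have "?rho j < ?rho i"
    using rho_outside_less[OF jM j(2) sparse X noise[OF jM]]
      rho_inside_greater[OF i(1) sparse X noise[OF iM]] gap
    by (simp add: algebra_simps)
  with top[OF j(1) iM i(2)] show False by simp
qed

text \<open>The normal equations say that the error \<open>e = z - x\<close> satisfies \<open>D\<^sup>T D e = D\<^sup>T w\<close> on the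
  selected blocks; pair this with \<open>e\<close>.\<close>
lemma bth_estimate_error:
  assumes est: "bth_estimate L (M * d) d D (\<lambda>r. matvec (M * d) D x r + w r) Sh z"
    and Sh: "Sh \<subseteq> {..<M}" "card Sh = k" and supp: "bsupp d M x \<subseteq> Sh"
    and pos: "0 < 1 - (real d - 1) * \<nu> - (real k - 1) * real d * \<mu>B"
    and noise: "\<And>i. i < M \<Longrightarrow> L2_set (\<lambda>a. \<Sum>r<L. D r a * w r) (blk d i) \<le> \<tau>"
  shows "(\<Sum>j<M * d. (z j - x j)\<^sup>2)
    \<le> real k * \<tau>\<^sup>2 / (1 - (real d - 1) * \<nu> - (real k - 1) * real d * \<mu>B)\<^sup>2"
proof -
  define c where "c = 1 - (real d - 1) * \<nu> - (real k - 1) * real d * \<mu>B"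
  define e where "e = (\<lambda>j. z j - x j)"
  have fin: "finite Sh" using Sh(1) finite_subset by blast
  \<comment> \<open>Off \<open>Sh\<close> the signal vanishes by \<open>supp\<close>, and the
    estimate by its zero filling, since disjoint blocks keep \<open>j\<close> out of every selected
    block.\<close>
  have e0: "e j = 0" if "i < M" "i \<notin> Sh" "j \<in> blk d i" for i j
  proof -
    have "x j = 0" using that supp by (auto simp: bsupp_def)
    moreover have "z j = 0"
      using est blk_less[OF that(3,1)] that blk_disjoint unfolding bth_estimate_def by blast
    ultimately show ?thesis by (simp add: e_def)
  qed
  then have b0: "bnorm d e i = 0" if "i < M" "i \<notin> Sh" for i
    using that by (simp add: bnorm_def)
  have lin: "matvec (M * d) D e r = matvec (M * d) D z r - matvec (M * d) D x r" for r
    by (simp add: matvec_def e_def right_diff_distrib sum_subtractf)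
  have normal: "(\<Sum>r<L. D r a * matvec (M * d) D e r) = (\<Sum>r<L. D r a * w r)"
    if "i \<in> Sh" "a \<in> blk d i" for i a
  proof -
    have "a < M * d" using blk_less[OF that(2)] that(1) Sh(1) by auto
    then have "(\<Sum>r<L. D r a * (matvec (M * d) D x r + w r - matvec (M * d) D z r)) = 0"
      using est that unfolding bth_estimate_def by blast
    then show ?thesis by (simp add: lin algebra_simps sum.distrib sum_subtractf)
  qed
  define B where "B = L2_set (bnorm d e) Sh"
  have B2: "B\<^sup>2 = (\<Sum>i\<in>Sh. (bnorm d e i)\<^sup>2)"
    by (simp add: B_def L2_set_def sum_nonneg)
  have "c * B\<^sup>2 \<le> (\<Sum>a<M * d. e a * (\<Sum>r<L. D r a * matvec (M * d) D e r))"
    unfolding c_def B2 by (rule gram_lower_bound[OF Sh b0])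
  also have "\<dots> = (\<Sum>i\<in>Sh. \<Sum>a\<in>blk d i. e a * (\<Sum>r<L. D r a * matvec (M * d) D e r))"
    unfolding sum_blocks using Sh(1) e0 by (intro sum.mono_neutral_right) auto
  also have "\<dots> = (\<Sum>i\<in>Sh. \<Sum>a\<in>blk d i. e a * (\<Sum>r<L. D r a * w r))"
    by (intro sum.cong refl) (simp add: normal)
  also have "\<dots> \<le> (\<Sum>i\<in>Sh. bnorm d e i * \<tau>)"
  proof (intro sum_mono)
    fix i assume "i \<in> Sh"
    then have iM: "i < M" using Sh(1) by auto
    have "(\<Sum>a\<in>blk d i. e a * (\<Sum>r<L. D r a * w r))
        \<le> bnorm d e i * L2_set (\<lambda>a. \<Sum>r<L. D r a * w r) (blk d i)"
      unfolding bnorm_L2_set by (rule order_trans[OF abs_ge_self L2_set_mult_le])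
    also have "\<dots> \<le> bnorm d e i * \<tau>"
      by (intro mult_left_mono noise iM) simp
    finally show "(\<Sum>a\<in>blk d i. e a * (\<Sum>r<L. D r a * w r)) \<le> bnorm d e i * \<tau>" .
  qed
  \<comment> \<open>Cauchy-Schwarz against the constant \<tau> over \<open>k\<close> blocks produces
    the factor \<open>sqrt k\<close>.\<close>
  also have "\<dots> \<le> B * L2_set (\<lambda>_. \<tau>) Sh"
    unfolding B_def by (rule order_trans[OF abs_ge_self L2_set_mult_le])
  also have "\<dots> = B * (sqrt (real k) * \<bar>\<tau>\<bar>)"
    by (simp add: L2_set_constant Sh(2))
  finally have *: "c * B\<^sup>2 \<le> B * (sqrt (real k) * \<bar>\<tau>\<bar>)" .
  have B: "B \<ge> 0" by (simp add: B_def)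
  have c: "c > 0" using pos by (simp add: c_def)
  have "c * B \<le> sqrt (real k) * \<bar>\<tau>\<bar>"
  proof (cases "B = 0")
    case False
    with B * show ?thesis by (simp add: power2_eq_square mult.left_commute)
  qed simp
  then have "(c * B)\<^sup>2 \<le> (sqrt (real k) * \<bar>\<tau>\<bar>)\<^sup>2"
    using B c by (intro power_mono) auto
  then have "B\<^sup>2 \<le> real k * \<tau>\<^sup>2 / c\<^sup>2"
    using c by (simp add: power_mult_distrib field_simps)
  moreover have "(\<Sum>j<M * d. (z j - x j)\<^sup>2) = B\<^sup>2"
  proof -
    have "(\<Sum>j<M * d. (z j - x j)\<^sup>2) = (\<Sum>i<M. (bnorm d e i)\<^sup>2)"
      by (simp add: sum_blocks bnorm_square e_def)
    also have "\<dots> = B\<^sup>2"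
      unfolding B2 using Sh(1) b0 by (intro sum.mono_neutral_right) auto
    finally show ?thesis .
  qed
  ultimately show ?thesis by (simp add: c_def)
qed

end

subsection \<open>Performance of the thresholding algorithm\<close>

lemma bnorm_pos:
  assumes "l \<in> bsupp d M x"
  shows "bnorm d x l > 0"
proof -
  have "bnorm d x l \<noteq> 0"
    using assms by (auto simp: bsupp_def bnorm_L2_set L2_set_eq_0_iff)
  with bnorm_nonneg[of d x l] show ?thesis by linarith
qed

lemma gauss_noise_eq: "gauss_noise L \<sigma> = gaussian_vector {..<L} \<sigma>"
  by (simp add: gauss_noise_def gaussian_vector_def)

text \<open>The transposition bound with \<open>A = D[i]\<close>: the \<open>L\<close> noise
  coordinates are replaced by the \<open>d\<close> coordinates of the block.\<close>

lemma block_noise_tail: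
  fixes \<sigma> t :: real
  assumes "d > 0" and unit_cols: "\<forall>j<M * d. (\<Sum>r<L. (D r j)\<^sup>2) = 1"
    and "i < M" "\<sigma> > 0" "t \<ge> 1"
  shows "measure (gauss_noise L \<sigma>) {w \<in> space (gauss_noise L \<sigma>).
      \<sigma>\<^sup>2 * (1 + (real d - 1) * sub_coherence L M d D) * t \<le> (\<Sum>a\<in>blk d i. (\<Sum>r<L. D r a * w r)\<^sup>2)}
    < 0.8 * (real d)\<^sup>2 * t powr (real d / 2 - 1) * exp (- t / 2)"
proof -
  have "0 \<le> (real d - 1) * sub_coherence L M d D"
    using assms(1) sub_coherence_nonneg by (intro mult_nonneg_nonneg) auto
  then have "measure (gauss_noise L \<sigma>) {w \<in> space (gauss_noise L \<sigma>).
      \<sigma>\<^sup>2 * (1 + (real d - 1) * sub_coherence L M d D) * t \<le> (\<Sum>a\<in>blk d i. (\<Sum>r<L. D r a * w r)\<^sup>2)}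
    \<le> chi_square_tail (blk d i) t"
    unfolding gauss_noise_eq using assms
    by (intro gaussian_tail_le_chi_square block_operator_norm_le) auto
  also have "\<dots> < 0.8 * (real d)\<^sup>2 * t powr (real d / 2 - 1) * exp (- t / 2)"
    using assms by (intro chi_square_tail_less) auto
  finally show ?thesis .
qed

text \<open>Union bound over the \<open>M\<close> blocks; strictness survives because
  \<open>M > 0\<close> makes the sum nonempty.\<close>

lemma noise_event_prob:
  fixes \<sigma> t :: real
  assumes "d > 0" "M > 0" and unit_cols: "\<forall>j<M * d. (\<Sum>r<L. (D r j)\<^sup>2) = 1"
    and "\<sigma> > 0" "t \<ge> 1"
  defines "E \<equiv> {w \<in> space (gauss_noise L \<sigma>). \<forall>i<M. (\<Sum>a\<in>blk d i. (\<Sum>r<L. D r a * w r)\<^sup>2)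
      < \<sigma>\<^sup>2 * (1 + (real d - 1) * sub_coherence L M d D) * t}"
  shows "E \<in> sets (gauss_noise L \<sigma>)"
    and "measure (gauss_noise L \<sigma>) E
      > 1 - real M * (0.8 * (real d)\<^sup>2 * t powr (real d / 2 - 1) * exp (- t / 2))"
proof -
  let ?G = "gauss_noise L \<sigma>"
  interpret prob_space ?G
    unfolding gauss_noise_eq using assms by (intro prob_space_gaussian_vector)
  have [measurable_cong]: "sets ?G = sets (PiM {..<L} (\<lambda>_. borel))"
    unfolding gauss_noise_eq by (rule sets_gaussian_vector)
  define Bad where "Bad i = {w \<in> space ?G.
      \<sigma>\<^sup>2 * (1 + (real d - 1) * sub_coherence L M d D) * t \<le> (\<Sum>a\<in>blk d i. (\<Sum>r<L. D r a * w r)\<^sup>2)}" for i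
  have Bad [measurable]: "Bad i \<in> sets ?G" for i
    unfolding Bad_def by measurable
  show E: "E \<in> sets ?G"
    unfolding E_def by measurable
  have "space ?G - E = (\<Union>i<M. Bad i)"
    unfolding E_def Bad_def by (auto simp: not_less)
  then have "1 - prob E = prob (\<Union>i<M. Bad i)"
    using prob_compl[OF E] by simp
  also have "\<dots> \<le> (\<Sum>i<M. prob (Bad i))"
    by (intro finite_measure_subadditive_finite) (auto intro: Bad)
  also have "\<dots> < (\<Sum>i<M. 0.8 * (real d)\<^sup>2 * t powr (real d / 2 - 1) * exp (- t / 2))"
    unfolding Bad_def using assms by (intro sum_strict_mono block_noise_tail) auto
  finally show "prob E > 1 - real M * (0.8 * (real d)\<^sup>2 * t powr (real d / 2 - 1) * exp (- t / 2))"
    by simp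
qed

text \<open>The probability is that of a measurable event inside the set of good noise vectors, so
  measurability of that set, which quantifies over all admissible selections and estimates, does not
  have to be shown.\<close>

theorem theorem4:
  fixes L M d k :: nat and D :: "nat \<Rightarrow> nat \<Rightarrow> real" and x :: "nat \<Rightarrow> real"
    and \<sigma> \<alpha> :: real
  defines "N \<equiv> M * d"
  defines "S \<equiv> bsupp d M x"
  defines "\<mu>B \<equiv> block_coherence L M d D"
  defines "\<nu> \<equiv> sub_coherence L M d D"
  defines "xmax \<equiv> Max ((bnorm d x) ` S)"
  defines "xmin \<equiv> Min ((bnorm d x) ` S)"
  assumes unit_cols: "\<forall>j<N. (\<Sum>r<L. (D r j)^2) = 1"
    and LN: "L < N"
    and rank: "\<forall>I. I \<subseteq> {..<M} \<and> card I \<le> k \<longrightarrow> full_col_rank_on L N d D I"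
    and sparse: "card S \<le> k"
    and nonzero: "\<exists>j<N. x j \<noteq> 0"
    and sigma_pos: "\<sigma> > 0"
    and alpha: "\<alpha> \<ge> 1 / (2 * real d * ln (real N))"
    and cond: "(1 - (real d - 1) * \<nu>) * xmin - (2 * real k - 1) * real d * \<mu>B * xmax
               \<ge> 2 * \<sigma> * sqrt (2 * \<alpha> * real d * (1 + (real d - 1) * \<nu>) * ln (real N))"
  shows "\<exists>E \<in> sets (gauss_noise L \<sigma>).
     measure (gauss_noise L \<sigma>) E >
       1 - 0.8 * real d * (2 * \<alpha> * real d * ln (real N)) powr (real d / 2 - 1)
             / (real N) powr (\<alpha> * real d - 1)
     \<and> E \<subseteq> {w \<in> space (gauss_noise L \<sigma>).
          \<forall>Sh z. bth_select L M d k D (\<lambda>r. matvec N D x r + w r) Sh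
                 \<and> bth_estimate L N d D (\<lambda>r. matvec N D x r + w r) Sh z
               \<longrightarrow> S \<subseteq> Sh \<and>
                   (\<Sum>j<N. (z j - x j)^2)
                     \<le> 2 * \<alpha> * (1 + (real d - 1) * \<nu>)
                        / (1 - (real d - 1) * \<nu> - (real k - 1) * real d * \<mu>B)^2
                        * real d * real k * \<sigma>^2 * ln (real N)}"
proof -
  have N: "N > 0" using nonzero by auto
  then have d: "d > 0" and M: "M > 0" by (auto simp: N_def)
  have cols: "\<forall>j<M * d. (\<Sum>r<L. (D r j)\<^sup>2) = 1" using unit_cols by (simp add: N_def)
  \<comment> \<open>With no rows a column could not have norm 1; then \<open>L < N\<close> gives
    \<open>N > 1\<close>, so the logarithm is positive.\<close>
  have "L > 0"
  proof (rule ccontr)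
    assume "\<not> L > 0"
    then show False using unit_cols N by auto
  qed
  then have "N > 1" using LN by simp
  then have lnN: "ln (real N) > 0" by simp
  \<comment> \<open>The chi-square threshold: \<open>exp (- t / 2)\<close> equals
    \<open>N powr (- \<alpha> * d)\<close>, and the assumption on \<alpha> says exactly
    \<open>t \<ge> 1\<close>.\<close>
  define t where "t = 2 * \<alpha> * real d * ln (real N)"
  define \<kappa> where "\<kappa> = 1 + (real d - 1) * \<nu>"
  \<comment> \<open>Half of the right side of \<open>cond\<close>.\<close>
  define \<tau> where "\<tau> = \<sigma> * sqrt (\<kappa> * t)"
  define c where "c = 1 - (real d - 1) * \<nu> - (real k - 1) * real d * \<mu>B"
  have t: "t \<ge> 1"
    using alpha d lnN by (simp add: t_def field_simps)
  have "0 \<le> (real d - 1) * \<nu>"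
    using d sub_coherence_nonneg unfolding \<nu>_def by (intro mult_nonneg_nonneg) auto
  then have \<kappa>: "\<kappa> \<ge> 1" by (simp add: \<kappa>_def)
  have \<tau>: "\<tau> > 0" "\<tau>\<^sup>2 = \<sigma>\<^sup>2 * \<kappa> * t"
    using sigma_pos \<kappa> t by (auto simp: \<tau>_def power_mult_distrib)
  have \<mu>: "\<mu>B \<ge> 0" unfolding \<mu>B_def by (rule block_coherence_nonneg)
  have finS: "finite S" by (simp add: S_def bsupp_def)
  obtain i0 where i0: "i0 \<in> S"
  proof -
    obtain j where j: "j < M * d" "x j \<noteq> 0" using nonzero by (auto simp: N_def)
    \<comment> \<open>A nonzero sum of squares, regrouped by blocks, exhibits a nonzero
      block.\<close>
    have "(\<Sum>j<M * d. (x j)\<^sup>2) \<noteq> 0"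
      using j by (subst sum_nonneg_eq_0_iff) auto
    then have "\<exists>i<M. \<exists>j\<in>blk d i. x j \<noteq> 0"
      unfolding sum_blocks by (metis (no_types, lifting) lessThan_iff power_zero_numeral sum.neutral)
    then show ?thesis using that by (auto simp: S_def bsupp_def)
  qed
  have k: "k \<ge> 1" using i0 finS sparse by (metis One_nat_def Suc_leI card_gt_0_iff empty_iff order_less_le_trans)
  have Xmax: "bnorm d x l \<le> xmax" if "l \<in> S" for l
    unfolding xmax_def using finS that by (intro Max_ge) auto
  have Xmin: "xmin \<le> bnorm d x l" if "l \<in> S" for l
    unfolding xmin_def using finS that by (intro Min_le) auto
  have "bnorm d x l > 0" if "l \<in> S" for l
    using that unfolding S_def by (rule bnorm_pos)
  then have xmin_pos: "xmin > 0"
    unfolding xmin_def using finS i0 by (subst Min_gr_iff) auto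
  have minmax: "xmin \<le> xmax" using Xmin[OF i0] Xmax[OF i0] by linarith
  have gap: "2 * \<tau> \<le> (1 - (real d - 1) * \<nu>) * xmin - (2 * real k - 1) * real d * \<mu>B * xmax"
  proof -
    have "\<kappa> * t = 2 * \<alpha> * real d * (1 + (real d - 1) * \<nu>) * ln (real N)"
      by (simp add: \<kappa>_def t_def algebra_simps)
    then show ?thesis using cond by (simp add: \<tau>_def)
  qed
  \<comment> \<open>Positivity of the denominator follows from the gap: as
    \<open>(k - 1) * xmin \<le> (2 * k - 1) * xmax\<close>, the left side of \<open>cond\<close> is
    at most \<open>c * xmin\<close>, and it is at least \<open>2 * \<tau> > 0\<close>.\<close>
  have c: "c > 0"
  proof -
    have "(real k - 1) * real d * \<mu>B * xmin \<le> (2 * real k - 1) * real d * \<mu>B * xmax"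
      using k \<mu> xmin_pos minmax by (intro mult_mono mult_nonneg_nonneg) auto
    then have "c * xmin > 0" using gap \<tau>(1) by (simp add: c_def algebra_simps)
    then show ?thesis using xmin_pos by (simp add: zero_less_mult_iff)
  qed
  moreover have "0 \<le> (real k - 1) * real d * \<mu>B"
    using k \<mu> by (intro mult_nonneg_nonneg) auto
  ultimately have diag: "0 \<le> 1 - (real d - 1) * \<nu>" by (simp add: c_def)
  define E where "E = {w \<in> space (gauss_noise L \<sigma>). \<forall>i<M. (\<Sum>a\<in>blk d i. (\<Sum>r<L. D r a * w r)\<^sup>2)
      < \<sigma>\<^sup>2 * (1 + (real d - 1) * \<nu>) * t}"
  note E_event = noise_event_prob[OF d M cols sigma_pos t, folded \<nu>_def, folded E_def]
  \<comment> \<open>One factor \<open>d\<close> of \<open>d\<^sup>2\<close> joins \<open>M\<close>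
    to form \<open>N\<close>, and \<open>N * exp (- t / 2)\<close> is the reciprocal of
    \<open>N powr (\<alpha> * d - 1)\<close>.\<close>
  have rate: "real M * (0.8 * (real d)\<^sup>2 * t powr (real d / 2 - 1) * exp (- t / 2))
      = 0.8 * real d * t powr (real d / 2 - 1) / real N powr (\<alpha> * real d - 1)"
  proof -
    have "real N powr (\<alpha> * real d - 1) = exp (t / 2 - ln (real N))"
      using N by (simp add: powr_def t_def algebra_simps)
    also have "\<dots> = exp (t / 2) / real N" using N by (simp add: exp_diff)
    finally have *: "real N powr (\<alpha> * real d - 1) = exp (t / 2) / real N" .
    have "exp (- t / 2) = 1 / exp (t / 2)"
      using exp_minus_inverse[of "t / 2"] by (simp add: eq_divide_eq mult.commute)
    then show ?thesis
      unfolding * by (simp add: N_def power2_eq_square)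
  qed
  \<comment> \<open>On the noise event everything is deterministic, for any tie-breaking and any
    solution of the normal equations.\<close>
  have sound: "S \<subseteq> Sh \<and> (\<Sum>j<N. (z j - x j)\<^sup>2)
      \<le> 2 * \<alpha> * (1 + (real d - 1) * \<nu>) / (1 - (real d - 1) * \<nu> - (real k - 1) * real d * \<mu>B)\<^sup>2
        * real d * real k * \<sigma>\<^sup>2 * ln (real N)"
    if w: "w \<in> E" and sel: "bth_select L M d k D (\<lambda>r. matvec N D x r + w r) Sh"
      and est: "bth_estimate L N d D (\<lambda>r. matvec N D x r + w r) Sh z" for w Sh z
  proof -
    have noise: "L2_set (\<lambda>a. \<Sum>r<L. D r a * w r) (blk d i) < \<tau>" if "i < M" for i
    proof -
      have "(\<Sum>a\<in>blk d i. (\<Sum>r<L. D r a * w r)\<^sup>2) < \<tau>\<^sup>2"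
        using w that by (simp add: E_def \<tau>(2) \<kappa>_def)
      then have "sqrt (\<Sum>a\<in>blk d i. (\<Sum>r<L. D r a * w r)\<^sup>2) < sqrt (\<tau>\<^sup>2)"
        by (rule real_sqrt_less_mono)
      then show ?thesis using \<tau>(1) by (simp add: L2_set_def)
    qed
    have sub: "S \<subseteq> Sh"
      unfolding S_def
      using xmin_pos minmax Xmax Xmin
      by (intro bth_select_support[OF d cols sel[unfolded N_def] sparse[unfolded S_def], where X = xmax and Y = xmin and \<tau> = \<tau>]
          diag[unfolded \<nu>_def] gap[unfolded \<nu>_def \<mu>B_def] noise)
        (auto simp: S_def)
    have Sh: "Sh \<subseteq> {..<M}" "card Sh = k" using sel by (auto simp: bth_select_def)
    have "(\<Sum>j<N. (z j - x j)\<^sup>2) \<le> real k * \<tau>\<^sup>2 / c\<^sup>2"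
      using bth_estimate_error[OF d cols est[unfolded N_def] Sh sub[unfolded S_def] c[unfolded c_def \<nu>_def \<mu>B_def]
          less_imp_le[OF noise]]
      unfolding c_def \<nu>_def \<mu>B_def N_def .
    also have "\<dots> = 2 * \<alpha> * \<kappa> / c\<^sup>2 * real d * real k * \<sigma>\<^sup>2 * ln (real N)"
      by (simp add: \<tau>(2) t_def)
    finally show ?thesis using sub by (simp only: \<kappa>_def c_def simp_thms)
  qed
  show ?thesis
  proof (intro bexI[of _ E] conjI)
    show "E \<in> sets (gauss_noise L \<sigma>)" by (rule E_event(1))
    show "measure (gauss_noise L \<sigma>) E
        > 1 - 0.8 * real d * (2 * \<alpha> * real d * ln (real N)) powr (real d / 2 - 1)
          / real N powr (\<alpha> * real d - 1)"
      using E_event(2)[unfolded rate] unfolding t_def .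
    show "E \<subseteq> {w \<in> space (gauss_noise L \<sigma>).
          \<forall>Sh z. bth_select L M d k D (\<lambda>r. matvec N D x r + w r) Sh
                 \<and> bth_estimate L N d D (\<lambda>r. matvec N D x r + w r) Sh z
               \<longrightarrow> S \<subseteq> Sh \<and>
                   (\<Sum>j<N. (z j - x j)^2)
                     \<le> 2 * \<alpha> * (1 + (real d - 1) * \<nu>)
                        / (1 - (real d - 1) * \<nu> - (real k - 1) * real d * \<mu>B)^2
                        * real d * real k * \<sigma>^2 * ln (real N)}"
    proof
      fix w assume w: "w \<in> E"
      then have "w \<in> space (gauss_noise L \<sigma>)" by (simp add: E_def)
      with sound[OF w] show "w \<in> {w \<in> space (gauss_noise L \<sigma>).
          \<forall>Sh z. bth_select L M d k D (\<lambda>r. matvec N D x r + w r) Sh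
                 \<and> bth_estimate L N d D (\<lambda>r. matvec N D x r + w r) Sh z
               \<longrightarrow> S \<subseteq> Sh \<and>
                   (\<Sum>j<N. (z j - x j)^2)
                     \<le> 2 * \<alpha> * (1 + (real d - 1) * \<nu>)
                        / (1 - (real d - 1) * \<nu> - (real k - 1) * real d * \<mu>B)^2
                        * real d * real k * \<sigma>^2 * ln (real N)}"
        by blast
    qed
  qed
qed

end
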